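(* Let $N\ge 0$. As modules over the small quantum group $u_q(\mathfrak{sl}_2)$, $$T(1)^{\otimes N}\cong\bigoplus_{0\le k_0\le l-2}T(k_0)^{\oplus M^{(l)}_{k_0}(N)}\oplus T_+(l-1)^{\oplus m^{(l)}_{l-1,+}(N)}\oplus T_-(l-1)^{\oplus m^{(l)}_{l-1,-}(N)}\oplus\bigoplus_{0\le k_0\le l-2}T_+(l+k_0)^{\oplus m^{(l)}_{l+k_0,+}(N)}\oplus\bigoplus_{0\le k_0\le l-2}T_-(l+k_0)^{\oplus m^{(l)}_{l+k_0,-}(N)},$$ where $$m^{(l)}_{l-1,+}(N)=\sum_{j\in\mathbb{Z},\ j\text{ even}}m^{(l)}_{l-1,j}(N),\qquad m^{(l)}_{l-1,-}(N)=\sum_{j\in\mathbb{Z},\ j\text{ odd}}m^{(l)}_{l-1,j}(N),$$ $$m^{(l)}_{l+k_0,+}(N)=\sum_{j\in\mathbb{Z},\ j\text{ even}}m^{(l)}_{l+k_0,j}(N),\qquad m^{(l)}_{l+k_0,-}(N)=\sum_{j\in\mathbb{Z},\ j\text{ odd}}m^{(l)}_{l+k_0,j}(N).$$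
   Context: Let $l\ge 3$ be an odd integer, $a$ an integer coprime to $l$, and $q=e^{\pi i a/l}$, assumed to be a primitive $2l$-th root of unity (so $q^l=-1$). For a formal variable $v$, $U_v(\mathfrak{sl}_2)$ is the Hopf algebra over $\mathbb{Q}(v)$ generated by $E,F,K^{\pm1}$ with $KK^{-1}=K^{-1}K=1$, $KE=v^2EK$, $KF=v^{-2}FK$, $EF-FE=\frac{K-K^{-1}}{v-v^{-1}}$, coproduct $\Delta E=E\otimes 1+K\otimes E$, $\Delta F=F\otimes K^{-1}+1\otimes F$, $\Delta K^{\pm1}=K^{\pm1}\otimes K^{\pm1}$, counit $\varepsilon(E)=\varepsilon(F)=0$, $\varepsilon(K^{\pm1})=1$, antipode $S(E)=-K^{-1}E$, $S(F)=-FK$, $S(K)=K^{-1}$. Put $[n]=\frac{v^n-v^{-n}}{v-v^{-1}}$, $[n]!=\prod_{s=1}^n[s]$, ${n\brack r}=\prod_{s=1}^r\frac{v^{n-s+1}-v^{-n+s-1}}{v^s-v^{-s}}$ for $n\in\mathbb{Z}$, $r\ge 0$, and ${K;c\brack t}=\prod_{s=1}^t\frac{Kv^{c-s+1}-K^{-1}v^{-c+s-1}}{v^s-v^{-s}}$. Let $\mathcal{A}=\mathbb{Z}[v,v^{-1}]$, let $U_{\mathcal{A}}$ be the $\mathcal{A}$-subalgebra generated by $K^{\pm1}$, $E^{(n)}=E^n/[n]!$, $F^{(n)}=F^n/[n]!$ ($n\ge0$), and $U_q(\mathfrak{sl}_2)=U_{\mathcal{A}}\otimes_{\mathcal{A}}\mathbb{Q}(q)$,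 $v\mapsto q$ (quantum integers and binomials are then evaluated at $q$). The small quantum group $u_q(\mathfrak{sl}_2)$ is the subalgebra of $U_q(\mathfrak{sl}_2)$ generated by $E,F,K^{\pm1}$. For $n\ge 0$ the Weyl module $W(n)$ has basis $x,F^{(1)}x,\dots,F^{(n)}x$ with (setting $F^{(t)}x=0$ for $t<0$ or $t>n$) $K F^{(t)}x=q^{n-2t}F^{(t)}x$, ${K;0\brack l}F^{(t)}x={n-2t\brack l}F^{(t)}x$, $FF^{(t)}x=[t+1]F^{(t+1)}x$, $EF^{(t)}x=[n-t+1]F^{(t-1)}x$, $F^{(l)}F^{(t)}x={l+t\brack l}F^{(l+t)}x$, $E^{(l)}F^{(t)}x={n+l-t\brack l}F^{(t-l)}x$. The dual Weyl module is $W^*(n)=\mathrm{Hom}(W(n),\mathbb{Q}(q))$ and $L(n)$ is the unique simple quotient of $W(n)$. A tilting module (of type $\mathbf{1}$) is a finite dimensional module having both a filtration with subquotients Weyl modules and a filtration with subquotients dual Weyl modules. For each $k\ge 0$, $T(k)$ is the unique indecomposable tilting module in which $W(k)$ occurs exactly once in a Weyl filtration and $W(k')$ does not occur for $k'>k$. In particular $T(1)=L(1)$. Let $M^{(l)}_k(N)$ be the multiplicity of $T(k)$ in the decomposition of $T(1)^{\otimes N}$ into indecomposable $U_q(\mathfrak{sl}_2)$-modules ($0$ if $T(k)$ does not occur). Let $U_q^0$ be the subalgebra of $U_q(\mathfrak{sl}_2)$ generated by $K^{\pm1}$ and all ${K;c\brack t}$ ($t\ge0$, $c\in\mathbb{Z}$),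 and $u_q^-U_q^0u_q^+$ the subalgebra generated by $F$, $U_q^0$, $E$. For $j\in\mathbb{Z}$, $\mathbb{C}[lj]$ is the one-dimensional $u_q^-U_q^0u_q^+$-module of weight $lj$: $E,F$ act by $0$, $K$ by $q^{lj}=(-1)^j$, ${K;c\brack t}$ by ${lj+c\brack t}$. Over $u_q^-U_q^0u_q^+$ one has a decomposition $$T(1)^{\otimes N}\cong\bigoplus_{0\le k_0\le l-2}T(k_0)^{\oplus M^{(l)}_{k_0}(N)}\oplus\bigoplus_{j\in\mathbb{Z}}(\mathbb{C}[lj]\otimes T(l-1))^{\oplus m^{(l)}_{l-1,j}(N)}\oplus\bigoplus_{j\in\mathbb{Z},\,0\le k_0\le l-2}(\mathbb{C}[lj]\otimes T(l+k_0))^{\oplus m^{(l)}_{l+k_0,j}(N)},$$ which defines the multiplicities $m^{(l)}_{l-1,j}(N)$, $m^{(l)}_{l+k_0,j}(N)$. Over $u_q(\mathfrak{sl}_2)$, for $l-1\le k\le 2l-2$, $T_+(k)$ denotes the restriction of $\mathbb{C}[lj]\otimes T(k)$ with $j$ even (i.e. the restriction of $T(k)$) and $T_-(k)$ the restriction of $\mathbb{C}[lj]\otimes T(k)$ with $j$ odd (i.e. $T_+(k)\otimes 1_-$, where $1_-$ is the one-dimensional module with $K\mapsto-1$, $E,F\mapsto0$). *)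

theory Defs
  imports
    "HOL-Algebra.Algebraic_Closure_Type"
    "HOL-Algebra.Generated_Fields"
    "HOL-Library.Poly_Mapping"
    "HOL-Computational_Algebra.Computational_Algebra"
    "Jordan_Normal_Form.Matrix"
begin

hide_const (open) Module.smult Polynomial.order

section \<open>Quantum integers\<close>

text \<open>\<open>Q(v)\<close> is the fraction field of the polynomial ring over the rationals.\<close>

type_synonym Qv = "rat poly fract"

definition vv :: Qv where
  "vv = to_fract [:0, 1:]"

definition qint :: "int \<Rightarrow> Qv" where
  "qint n = (vv powi n - vv powi (- n)) / (vv - inverse vv)"

definition qfact :: "nat \<Rightarrow> Qv" where
  "qfact n = (\<Prod>s=1..n. qint (int s))"

definition qbinom :: "int \<Rightarrow> nat \<Rightarrow> Qv" where
  "qbinom n r = (\<Prod>s=1..r. (vv powi (n - int s + 1) - vv powi (- n + int s - 1)) /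
                            (vv powi int s - vv powi (- int s)))"

definition int_Laurent :: "Qv set" where
  "int_Laurent = {to_fract (map_poly of_int p) / vv ^ n |(p :: int poly) n. True}"

text \<open>The specialization \<open>v \<mapsto> q\<close> is only defined on integral Laurent polynomials: numerator and
  denominator of a quantum binomial may both vanish at \<open>q\<close>.\<close>

definition spec :: "complex \<Rightarrow> Qv \<Rightarrow> complex" where
  "spec q f = (THE z. \<exists>(p :: int poly) n.
     f = to_fract (map_poly of_int p) / vv ^ n \<and> z = poly (map_poly of_int p) q / q ^ n)"

definition Qq :: "complex \<Rightarrow> complex set" where
  "Qq q = generate_field ring_of_type_algebra {q}"

definition primitive_root_of_unity :: "nat \<Rightarrow> complex \<Rightarrow> bool" where
  "primitive_root_of_unity n z \<longleftrightarrow> n > 0 \<and> z ^ n = 1 \<and> (\<forall>m. 0 < m \<and> m < n \<longrightarrow> z ^ m \<noteq> 1)"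


section \<open>The quantum groups\<close>

text \<open>The algebra of the monoid \<open>G\<close> with coefficients in the subring \<open>S\<close>. The multiplication of the
  type of finitely supported functions cannot be used here, as it convolves along the \<^emph>\<open>addition\<close> of
  the index type.\<close>

definition monoid_algebra :: "'k::comm_ring_1 set \<Rightarrow> ('m, 'z) monoid_scheme \<Rightarrow> ('m \<Rightarrow>\<^sub>0 'k) ring"
  where
  "monoid_algebra S G =
     \<lparr> carrier = {f. Poly_Mapping.keys f \<subseteq> carrier G \<and> (\<forall>x. Poly_Mapping.lookup f x \<in> S)},
       monoid.mult = (\<lambda>f g. \<Sum>x\<in>Poly_Mapping.keys f. \<Sum>y\<in>Poly_Mapping.keys g.
                 Poly_Mapping.single (x \<otimes>\<^bsub>G\<^esub> y) (Poly_Mapping.lookup f x * Poly_Mapping.lookup g y)),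
       one = Poly_Mapping.single \<one>\<^bsub>G\<^esub> 1,
       zero = 0,
       add = (+) \<rparr>"

text \<open>The ideals generated in \<open>monoid_algebra S G\<close> below are meaningful because it is a ring.\<close>

lemma lookup_sum_single: "finite A \<Longrightarrow> Poly_Mapping.keys f \<subseteq> A \<Longrightarrow> f = (\<Sum>x\<in>A. Poly_Mapping.single x (Poly_Mapping.lookup f x))"
  by (rule poly_mapping_eqI)
    (auto simp: lookup_sum lookup_single when_def sum.delta' in_keys_iff subset_iff if_distrib cong: if_cong)

context
  fixes G :: "('m, 'z) monoid_scheme"
begin

definition conv :: "('m \<Rightarrow>\<^sub>0 'k::comm_ring_1) \<Rightarrow> ('m \<Rightarrow>\<^sub>0 'k) \<Rightarrow> ('m \<Rightarrow>\<^sub>0 'k)" where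
  "conv f g = (\<Sum>x\<in>Poly_Mapping.keys f. \<Sum>y\<in>Poly_Mapping.keys g.
     Poly_Mapping.single (x \<otimes>\<^bsub>G\<^esub> y) (Poly_Mapping.lookup f x * Poly_Mapping.lookup g y))"

lemma conv_superset:
  assumes "finite A" "finite B" "Poly_Mapping.keys f \<subseteq> A" "Poly_Mapping.keys g \<subseteq> B"
  shows "conv f g = (\<Sum>x\<in>A. \<Sum>y\<in>B.
     Poly_Mapping.single (x \<otimes>\<^bsub>G\<^esub> y) (Poly_Mapping.lookup f x * Poly_Mapping.lookup g y))"
proof -
  have "conv f g = (\<Sum>x\<in>Poly_Mapping.keys f. \<Sum>y\<in>B.
     Poly_Mapping.single (x \<otimes>\<^bsub>G\<^esub> y) (Poly_Mapping.lookup f x * Poly_Mapping.lookup g y))"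
    unfolding conv_def using assms
    by (intro sum.cong refl sum.mono_neutral_left) (auto simp: in_keys_iff)
  also have "\<dots> = (\<Sum>x\<in>A. \<Sum>y\<in>B.
     Poly_Mapping.single (x \<otimes>\<^bsub>G\<^esub> y) (Poly_Mapping.lookup f x * Poly_Mapping.lookup g y))"
    using assms by (intro sum.mono_neutral_left) (auto simp: in_keys_iff)
  finally show ?thesis .
qed

lemma conv_add_left: "conv (f + g) h = conv f h + conv g h"
proof -
  let ?A = "Poly_Mapping.keys f \<union> Poly_Mapping.keys g"
  have "Poly_Mapping.keys (f + g) \<subseteq> ?A" by (rule Poly_Mapping.keys_add)
  then show ?thesis
    by (subst (1 2 3) conv_superset[where A = ?A and B = "Poly_Mapping.keys h"])
      (auto simp: lookup_add distrib_right single_add sum.distrib)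
qed

lemma conv_add_right: "conv h (f + g) = conv h f + conv h g"
proof -
  let ?A = "Poly_Mapping.keys f \<union> Poly_Mapping.keys g"
  have "Poly_Mapping.keys (f + g) \<subseteq> ?A" by (rule Poly_Mapping.keys_add)
  then show ?thesis
    by (subst (1 2 3) conv_superset[where B = ?A and A = "Poly_Mapping.keys h"])
      (auto simp: lookup_add distrib_left single_add sum.distrib)
qed

lemma conv_single: "conv (Poly_Mapping.single x a) (Poly_Mapping.single y b) = Poly_Mapping.single (x \<otimes>\<^bsub>G\<^esub> y) (a * b)"
  by (subst conv_superset[where A = "{x}" and B = "{y}"]) auto

lemma conv_zero [simp]: "conv 0 g = 0" "conv f 0 = 0"
  by (simp_all add: conv_def)

lemma conv_sum_left: "conv (\<Sum>i\<in>I. f i) g = (\<Sum>i\<in>I. conv (f i) g)"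
  by (induction I rule: infinite_finite_induct) (auto simp: conv_add_left)

lemma conv_sum_right: "conv g (\<Sum>i\<in>I. f i) = (\<Sum>i\<in>I. conv g (f i))"
  by (induction I rule: infinite_finite_induct) (auto simp: conv_add_right)
end

lemma poly_mapping_expand: "f = (\<Sum>x\<in>Poly_Mapping.keys f. Poly_Mapping.single x (Poly_Mapping.lookup f x))"
  by (rule lookup_sum_single) auto

lemma ring_monoid_algebra:
  fixes S :: "'k::comm_ring_1 set" and G :: "('m, 'z) monoid_scheme"
  assumes G: "Group.monoid G"
    and S: "0 \<in> S" "1 \<in> S" "\<And>a b. a \<in> S \<Longrightarrow> b \<in> S \<Longrightarrow> a + b \<in> S"
      "\<And>a b. a \<in> S \<Longrightarrow> b \<in> S \<Longrightarrow> a * b \<in> S" "\<And>a. a \<in> S \<Longrightarrow> - a \<in> S"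
  shows "ring (monoid_algebra S G)"
proof -
  interpret G: Group.monoid G by fact
  let ?C = "{f. Poly_Mapping.keys f \<subseteq> carrier G \<and> (\<forall>x. Poly_Mapping.lookup f x \<in> S)}"
  have C_add: "f + g \<in> ?C" if "f \<in> ?C" "g \<in> ?C" for f g
    using that Poly_Mapping.keys_add[of f g] by (auto simp: lookup_add intro!: S)
  have C_0: "0 \<in> ?C" by (auto intro: S)
  have C_sum: "sum f I \<in> ?C" if "\<And>i. i \<in> I \<Longrightarrow> f i \<in> ?C" for f and I :: "'m set"
    using that C_0 C_add by (induction I rule: infinite_finite_induct) auto
  have C_single: "Poly_Mapping.single x c \<in> ?C" if "x \<in> carrier G" "c \<in> S" for x c
    using that by (auto simp: lookup_single when_def intro: S)
  have C_conv: "conv G f g \<in> ?C" if "f \<in> ?C" "g \<in> ?C" for f g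
    unfolding conv_def using that by (intro C_sum C_single) (auto intro!: S)
  have assoc: "conv G (conv G f g) h = conv G f (conv G g h)"
    if "f \<in> ?C" "g \<in> ?C" "h \<in> ?C" for f g h
  proof -
    define e where "e = (\<lambda>f :: 'm \<Rightarrow>\<^sub>0 'k. \<Sum>x\<in>Poly_Mapping.keys f. Poly_Mapping.single x (Poly_Mapping.lookup f x))"
    have e: "e f = f" for f unfolding e_def by (rule poly_mapping_expand[symmetric])
    have "conv G (conv G (e f) (e g)) (e h) = conv G (e f) (conv G (e g) (e h))"
      unfolding e_def conv_sum_left conv_sum_right conv_single using that
      by (intro sum.cong refl) (auto simp: G.m_assoc subset_iff mult.assoc)
    then show ?thesis by (simp only: e)
  qed
  have one: "conv G (Poly_Mapping.single \<one>\<^bsub>G\<^esub> 1) f = f \<and> conv G f (Poly_Mapping.single \<one>\<^bsub>G\<^esub> 1) = f"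
    if "f \<in> ?C" for f
  proof -
    define e where "e = (\<lambda>f :: 'm \<Rightarrow>\<^sub>0 'k. \<Sum>x\<in>Poly_Mapping.keys f. Poly_Mapping.single x (Poly_Mapping.lookup f x))"
    have e: "e f = f" for f unfolding e_def by (rule poly_mapping_expand[symmetric])
    have "conv G (Poly_Mapping.single \<one>\<^bsub>G\<^esub> 1) (e f) = e f \<and> conv G (e f) (Poly_Mapping.single \<one>\<^bsub>G\<^esub> 1) = e f"
      unfolding e_def conv_sum_left conv_sum_right conv_single using that
      by (auto intro!: sum.cong simp: subset_iff)
    then show ?thesis by (simp only: e)
  qed
  have C_minus: "- f \<in> ?C" if "f \<in> ?C" for f
    using that by (auto simp: in_keys_iff intro: S)
  show ?thesis
  proof (rule ringI)
    have inv: "\<exists>g \<in> ?C. g + f = 0" if "f \<in> ?C" for f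
      using C_minus[OF that] by (intro bexI[of _ "- f"]) simp_all
    show "abelian_group (monoid_algebra S G)"
    proof (rule abelian_groupI, unfold monoid_algebra_def partial_object.simps ring.simps)
      show "f + g \<in> ?C" if "f \<in> ?C" "g \<in> ?C" for f g
        using that by (rule C_add)
      show "0 \<in> ?C" by (rule C_0)
      show "\<exists>g \<in> ?C. g + f = 0" if "f \<in> ?C" for f
        using that by (rule inv)
    qed (simp_all add: add_ac)
    show "Group.monoid (monoid_algebra S G)"
      by (rule monoidI) (use C_conv assoc one C_single S in \<open>auto simp: monoid_algebra_def conv_def[symmetric]\<close>)
  qed (auto simp: monoid_algebra_def conv_def[symmetric] conv_add_left conv_add_right)
qed

datatype letter = LE | LF | LK | LKinv

type_synonym free = "letter list \<Rightarrow>\<^sub>0 Qv"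

definition free_algebra :: "free ring" where
  "free_algebra = monoid_algebra UNIV \<lparr> carrier = UNIV, monoid.mult = (@), one = [] \<rparr>"

abbreviation word :: "letter list \<Rightarrow> Qv \<Rightarrow> free" where
  "word w c \<equiv> Poly_Mapping.single w c"

definition Uv_relations :: "free set" where
  "Uv_relations =
     { word [LK, LKinv] 1 - word [] 1,
       word [LKinv, LK] 1 - word [] 1,
       word [LK, LE] 1 - word [LE, LK] (vv\<^sup>2),
       word [LK, LF] 1 - word [LF, LK] (inverse (vv\<^sup>2)),
       word [LE, LF] 1 - word [LF, LE] 1
         - (word [LK] (1 / (vv - inverse vv)) - word [LKinv] (1 / (vv - inverse vv))) }"

definition Uv :: "free set ring" where
  "Uv = free_algebra Quot (Idl\<^bsub>free_algebra\<^esub> Uv_relations)"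

definition Uv_class :: "free \<Rightarrow> free set" where
  "Uv_class f = (Idl\<^bsub>free_algebra\<^esub> Uv_relations) +>\<^bsub>free_algebra\<^esub> f"

text \<open>One type of names serves for the generators of all algebras below: \<open>K\<close>, \<open>K\<^sup>-\<^sup>1\<close>, the divided
  powers \<open>E\<^sup>(\<^sup>n\<^sup>)\<close>, \<open>F\<^sup>(\<^sup>n\<^sup>)\<close> and \<open>[K;c,t]\<close>.\<close>

datatype gen = Kpos | Kneg | Ediv nat | Fdiv nat | Kbin int nat

fun free_Kbin :: "int \<Rightarrow> nat \<Rightarrow> free" where
  "free_Kbin c 0 = word [] 1"
| "free_Kbin c (Suc t) = free_Kbin c t \<otimes>\<^bsub>free_algebra\<^esub>
     (word [LK] (vv powi (c - int t) / (vv powi int (Suc t) - vv powi (- int (Suc t))))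
      - word [LKinv] (vv powi (- c + int t) / (vv powi int (Suc t) - vv powi (- int (Suc t)))))"

fun Uv_gen :: "gen \<Rightarrow> free set" where
  "Uv_gen Kpos = Uv_class (word [LK] 1)"
| "Uv_gen Kneg = Uv_class (word [LKinv] 1)"
| "Uv_gen (Ediv n) = Uv_class (word (replicate n LE) (1 / qfact n))"
| "Uv_gen (Fdiv n) = Uv_class (word (replicate n LF) (1 / qfact n))"
| "Uv_gen (Kbin c t) = Uv_class (free_Kbin c t)"

inductive_set UA :: "free set set" where
  "Uv_gen Kpos \<in> UA"
| "Uv_gen Kneg \<in> UA"
| "Uv_gen (Ediv n) \<in> UA"
| "Uv_gen (Fdiv n) \<in> UA"
| "f \<in> int_Laurent \<Longrightarrow> Uv_class (word [] f) \<in> UA"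
| "x \<in> UA \<Longrightarrow> y \<in> UA \<Longrightarrow> x \<oplus>\<^bsub>Uv\<^esub> y \<in> UA"
| "x \<in> UA \<Longrightarrow> y \<in> UA \<Longrightarrow> x \<otimes>\<^bsub>Uv\<^esub> y \<in> UA"

text \<open>The tensor product \<open>U\<^sub>A \<otimes>\<^sub>A Q(q)\<close> is the free \<open>Q(q)\<close>-vector space on the symbols \<open>x \<otimes> 1\<close> with
  \<open>x \<in> U\<^sub>A\<close>, multiplied by \<open>(x \<otimes> 1)(y \<otimes> 1) = xy \<otimes> 1\<close>, modulo additivity and
  \<open>fx \<otimes> 1 = f(q) (x \<otimes> 1)\<close> for \<open>f \<in> A\<close>.\<close>

type_synonym preUq = "free set \<Rightarrow>\<^sub>0 complex"

definition UA_algebra :: "complex \<Rightarrow> preUq ring" where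
  "UA_algebra q = monoid_algebra (Qq q) (Uv\<lparr>carrier := UA\<rparr>)"

definition Uq_relations :: "complex \<Rightarrow> preUq set" where
  "Uq_relations q =
     {Poly_Mapping.single (x \<oplus>\<^bsub>Uv\<^esub> y) 1 - Poly_Mapping.single x 1 - Poly_Mapping.single y 1
        | x y. x \<in> UA \<and> y \<in> UA}
     \<union> {Poly_Mapping.single (Uv_class (word [] f) \<otimes>\<^bsub>Uv\<^esub> x) 1 - Poly_Mapping.single x (spec q f)
        | f x. f \<in> int_Laurent \<and> x \<in> UA}"

definition Uq :: "complex \<Rightarrow> preUq set ring" where
  "Uq q = UA_algebra q Quot (Idl\<^bsub>UA_algebra q\<^esub> (Uq_relations q))"

definition Uq_class :: "complex \<Rightarrow> preUq \<Rightarrow> preUq set" where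
  "Uq_class q f = (Idl\<^bsub>UA_algebra q\<^esub> (Uq_relations q)) +>\<^bsub>UA_algebra q\<^esub> f"

text \<open>This uses \<open>[K;c,t] \<in> U\<^sub>A\<close>.\<close>

definition Uq_gen :: "complex \<Rightarrow> gen \<Rightarrow> preUq set" where
  "Uq_gen q g = Uq_class q (Poly_Mapping.single (Uv_gen g) 1)"

definition Uq_scalar :: "complex \<Rightarrow> complex \<Rightarrow> preUq set" where
  "Uq_scalar q c = Uq_class q (Poly_Mapping.single \<one>\<^bsub>Uv\<^esub> c)"

inductive_set subalg :: "complex \<Rightarrow> gen set \<Rightarrow> preUq set set" for q G where
  "g \<in> G \<Longrightarrow> Uq_gen q g \<in> subalg q G"
| "c \<in> Qq q \<Longrightarrow> Uq_scalar q c \<in> subalg q G"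
| "x \<in> subalg q G \<Longrightarrow> y \<in> subalg q G \<Longrightarrow> x \<oplus>\<^bsub>Uq q\<^esub> y \<in> subalg q G"
| "x \<in> subalg q G \<Longrightarrow> y \<in> subalg q G \<Longrightarrow> x \<otimes>\<^bsub>Uq q\<^esub> y \<in> subalg q G"

lemma ring_free_algebra: "ring free_algebra"
  unfolding free_algebra_def by (rule ring_monoid_algebra) (auto intro: Group.monoidI)

lemma ideal_Uv: "ideal (Idl\<^bsub>free_algebra\<^esub> Uv_relations) free_algebra"
  by (rule ring.genideal_ideal[OF ring_free_algebra]) (auto simp: free_algebra_def monoid_algebra_def)

lemma ring_Uv: "ring Uv"
  unfolding Uv_def by (rule ideal.quotient_is_ring[OF ideal_Uv])

lemma Uv_class_one: "Uv_class (word [] 1) = \<one>\<^bsub>Uv\<^esub>"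
  by (simp add: Uv_class_def Uv_def FactRing_def free_algebra_def monoid_algebra_def)

lemma Uv_class_carrier: "Uv_class f \<in> carrier Uv"
  unfolding Uv_class_def Uv_def FactRing_def
  by (auto simp: A_RCOSETS_def' free_algebra_def monoid_algebra_def)

lemma UA_subset: "UA \<subseteq> carrier Uv"
proof
  interpret ring Uv by (rule ring_Uv)
  show "x \<in> carrier Uv" if "x \<in> UA" for x
    using that by induction (auto simp: Uv_class_carrier)
qed

lemma one_in_UA: "\<one>\<^bsub>Uv\<^esub> \<in> UA"
  unfolding Uv_class_one[symmetric]
  by (rule UA.intros(5)) (auto simp: int_Laurent_def intro!: exI[of _ "1 :: int poly"] exI[of _ "0 :: nat"])

lemma subfield_Qq: "subfield (Qq q) (ring_of_type_algebra :: complex ring)"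
  unfolding Qq_def
  by (rule field.generate_field_is_subfield[OF field_from_type_algebra]) (auto simp: ring_of_type_algebra_def)

lemma Qq_closed:
  "0 \<in> Qq q" "1 \<in> Qq q" "a \<in> Qq q \<Longrightarrow> b \<in> Qq q \<Longrightarrow> a + b \<in> Qq q"
  "a \<in> Qq q \<Longrightarrow> b \<in> Qq q \<Longrightarrow> a * b \<in> Qq q" "a \<in> Qq q \<Longrightarrow> - a \<in> Qq q"
proof -
  have one: "1 \<in> Qq q" using generate_field.one[of ring_of_type_algebra "{q}"]
    by (simp add: Qq_def ring_of_type_algebra_def)
  have add: "a + b \<in> Qq q" if "a \<in> Qq q" "b \<in> Qq q" for a b
    using that generate_field.eng_add[of a ring_of_type_algebra "{q}" b]
    by (simp add: Qq_def ring_of_type_algebra_def)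
  have mult: "a * b \<in> Qq q" if "a \<in> Qq q" "b \<in> Qq q" for a b
    using that generate_field.eng_mult[of a ring_of_type_algebra "{q}" b]
    by (simp add: Qq_def ring_of_type_algebra_def)
  interpret F: Ring.field "ring_of_type_algebra :: complex ring" by (rule field_from_type_algebra)
  have "\<ominus>\<^bsub>ring_of_type_algebra\<^esub> a = - a" for a :: complex
    by (rule F.minus_equality) (auto simp: ring_of_type_algebra_def)
  then have uminus: "- a \<in> Qq q" if "a \<in> Qq q" for a
    using that generate_field.a_inv[of a ring_of_type_algebra "{q}"] by (simp add: Qq_def)
  show "1 \<in> Qq q" "a \<in> Qq q \<Longrightarrow> b \<in> Qq q \<Longrightarrow> a + b \<in> Qq q"
    "a \<in> Qq q \<Longrightarrow> b \<in> Qq q \<Longrightarrow> a * b \<in> Qq q" "a \<in> Qq q \<Longrightarrow> - a \<in> Qq q"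
    by (fact one, rule add, assumption, assumption, rule mult, assumption, assumption, rule uminus, assumption)
  show "0 \<in> Qq q" using add[OF one uminus[OF one]] by simp
qed

lemma ring_UA_algebra: "ring (UA_algebra q)"
proof -
  interpret ring Uv by (rule ring_Uv)
  have "Group.monoid (Uv\<lparr>carrier := UA\<rparr>)"
  proof (rule Group.monoidI)
    show "x \<otimes>\<^bsub>Uv\<lparr>carrier := UA\<rparr>\<^esub> y \<otimes>\<^bsub>Uv\<lparr>carrier := UA\<rparr>\<^esub> z = x \<otimes>\<^bsub>Uv\<lparr>carrier := UA\<rparr>\<^esub> (y \<otimes>\<^bsub>Uv\<lparr>carrier := UA\<rparr>\<^esub> z)"
      if "x \<in> carrier (Uv\<lparr>carrier := UA\<rparr>)" "y \<in> carrier (Uv\<lparr>carrier := UA\<rparr>)"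
        "z \<in> carrier (Uv\<lparr>carrier := UA\<rparr>)" for x y z
      using that UA_subset m_assoc[of x y z] by (simp add: subsetD)
    show "\<one>\<^bsub>Uv\<lparr>carrier := UA\<rparr>\<^esub> \<otimes>\<^bsub>Uv\<lparr>carrier := UA\<rparr>\<^esub> x = x"
      "x \<otimes>\<^bsub>Uv\<lparr>carrier := UA\<rparr>\<^esub> \<one>\<^bsub>Uv\<lparr>carrier := UA\<rparr>\<^esub> = x"
      if "x \<in> carrier (Uv\<lparr>carrier := UA\<rparr>)" for x
      using that UA_subset by (simp_all add: subsetD)
  qed (simp_all add: one_in_UA UA.intros(7))
  then show ?thesis
    unfolding UA_algebra_def by (rule ring_monoid_algebra) (auto intro: Qq_closed)
qed

text \<open>Generators of \<open>U\<^sub>q(sl\<^sub>2)\<close> (the \<open>[K;c,t]\<close> are redundant there, but they have to be kept in order to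
  restrict modules), of \<open>u\<^sub>q\<^sup>- U\<^sub>q\<^sup>0 u\<^sub>q\<^sup>+\<close> and of the small quantum group \<open>u\<^sub>q(sl\<^sub>2)\<close>.\<close>

definition gens_big :: "gen set" where
  "gens_big = UNIV"

definition gens_mid :: "gen set" where
  "gens_mid = {Fdiv 1, Ediv 1, Kpos, Kneg} \<union> {Kbin c t | c t. True}"

definition gens_small :: "gen set" where
  "gens_small = {Fdiv 1, Ediv 1, Kpos, Kneg}"


section \<open>Coproduct and antipode\<close>

text \<open>The coproduct and the antipode of \<open>U\<^sub>v(sl\<^sub>2)\<close> are determined by their values on \<open>E, F, K\<close>. The
  following computations give their values on \<open>E\<^sup>(\<^sup>n\<^sup>)\<close>, \<open>F\<^sup>(\<^sup>n\<^sup>)\<close> and \<open>[K;c,t]\<close>. They hold in any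
  \<open>Q(v)\<close>-algebra. For the coproduct, think of \<open>U\<^sub>v \<otimes> U\<^sub>v\<close> with \<open>E1 = E \<otimes> 1\<close>, \<open>E2 = 1 \<otimes> E\<close>,
  \<open>K1 = K \<otimes> 1\<close>, \<open>K2' = 1 \<otimes> K\<^sup>-\<^sup>1\<close> etc.; the elements \<open>K\<^sup>\<plusminus>\<^sup>1 \<otimes> 1\<close>, \<open>1 \<otimes> K\<^sup>\<plusminus>\<^sup>1\<close> generate a commutative
  subalgebra, in which \<open>comult_Kbin\<close> takes place.\<close>

lemma vv_nz [simp]: "vv \<noteq> 0"
  by (simp add: vv_def)

lemma to_fract_pow: "to_fract (p ^ n) = to_fract p ^ n"
  by (induction n) simp_all

lemma vv_power_eq_1: "vv ^ n = 1 \<Longrightarrow> n = 0"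
proof -
  assume "vv ^ n = 1"
  then have "to_fract ([:0, 1:] ^ n) = to_fract (1 :: rat poly)"
    by (simp add: vv_def to_fract_pow)
  then have "[:0, 1:] ^ n = (1 :: rat poly)" by (simp only: to_fract_eq_iff)
  then have "degree ([:0, 1:] ^ n :: rat poly) = 0" by simp
  then show "n = 0" by (simp add: degree_power_eq)
qed

lemma vv_diff_nz: "n > 0 \<Longrightarrow> vv powi int n - vv powi (- int n) \<noteq> 0"
proof
  assume "n > 0" and "vv powi int n - vv powi (- int n) = 0"
  then have "vv ^ n * vv ^ n = 1" by (simp add: power_int_minus field_simps)
  then have "vv ^ (n + n) = 1" by (simp add: power_add)
  then show False using vv_power_eq_1[of "n + n"] \<open>n > 0\<close> by simp
qed

lemma vv_diff_nz': "vv - inverse vv \<noteq> 0"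
  using vv_diff_nz[of 1] by (simp add: power_int_minus)

lemma qint_0 [simp]: "qint 0 = 0"
  by (simp add: qint_def)

lemma qint_nz: "n > 0 \<Longrightarrow> qint (int n) \<noteq> 0"
  using vv_diff_nz[of n] vv_diff_nz' by (simp add: qint_def)

lemma qfact_nz: "qfact n \<noteq> 0"
  unfolding qfact_def using qint_nz by (auto simp: Suc_le_eq)

lemma qfact_Suc: "qfact (Suc n) = qfact n * qint (int (Suc n))"
  by (simp add: qfact_def)

lemma qint_add: "qint (i + j) = vv powi (- i) * qint j + vv powi j * qint i"
proof -
  have "vv powi (i + j) - vv powi (- (i + j)) =
    vv powi (- i) * (vv powi j - vv powi (- j)) + vv powi j * (vv powi i - vv powi (- i))"
    by (simp add: power_int_add power_int_diff power_int_minus field_simps)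
  then show ?thesis by (simp add: qint_def add_divide_distrib)
qed

definition coef :: "nat \<Rightarrow> nat \<Rightarrow> Qv" where
  "coef p i = vv ^ (i * p) / (qfact p * qfact i)"

lemma coef_1: "(vv powi (- int i) * qint (int (Suc p))) * coef (Suc p) i = coef p i"
proof -
  have "vv powi (- int i) * vv ^ (i * Suc p) = vv ^ (i * p)"
    by (simp add: power_int_minus power_add)
  then show ?thesis
    using qint_nz[of "Suc p"] qfact_nz[of p] qfact_nz[of i]
    by (simp add: coef_def qfact_Suc divide_simps del: of_nat_Suc mult_Suc_right)
qed

lemma coef_2: "(vv ^ p * qint (int (Suc i))) * coef p (Suc i) = coef p i * vv ^ (2 * p)"
proof -
  have "vv ^ p * vv ^ (Suc i * p) = vv ^ (i * p) * vv ^ (2 * p)"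
    unfolding power_add[symmetric] by (rule arg_cong[where f = "\<lambda>k. vv ^ k"]) simp
  then show ?thesis
    using qint_nz[of "Suc i"] qfact_nz[of p] qfact_nz[of i]
    by (simp add: coef_def qfact_Suc divide_simps del: of_nat_Suc mult_Suc)
qed

locale central_hom =
  fixes \<iota> :: "Qv \<Rightarrow> 'r::ring_1"
  assumes \<iota>_add: "\<iota> (a + b) = \<iota> a + \<iota> b"
    and \<iota>_mult: "\<iota> (a * b) = \<iota> a * \<iota> b"
    and \<iota>_1: "\<iota> 1 = 1"
    and \<iota>_central: "\<iota> a * x = x * \<iota> a"
begin

lemma \<iota>_0: "\<iota> 0 = 0"
  using \<iota>_add[of 0 0] by simp

lemma \<iota>_minus: "\<iota> (- a) = - \<iota> a"
  using \<iota>_add[of a "- a"] \<iota>_0 by (simp add: eq_neg_iff_add_eq_0 add.commute)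

lemma \<iota>_cancel: "a \<noteq> 0 \<Longrightarrow> \<iota> a * x = \<iota> a * y \<Longrightarrow> x = y"
proof -
  assume "a \<noteq> 0" and "\<iota> a * x = \<iota> a * y"
  then have "\<iota> (inverse a * a) * x = \<iota> (inverse a * a) * y"
    by (simp only: \<iota>_mult mult.assoc)
  with \<open>a \<noteq> 0\<close> show "x = y" by (simp add: \<iota>_1)
qed

lemma \<iota>_left: "\<iota> a * (\<iota> b * x) = \<iota> (a * b) * x"
  by (simp add: \<iota>_mult mult.assoc)

lemma \<iota>_pull: "x * (\<iota> a * y) = \<iota> a * (x * y)"
  unfolding mult.assoc[symmetric] \<iota>_central[of a x] ..

lemma split_sum:
  "\<iota> (qint (int (Suc n))) * (\<Sum>i\<le>Suc n. A i) =
   (\<Sum>i\<le>n. \<iota> (vv powi (- int i) * qint (int (Suc n - i))) * A i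
          + \<iota> (vv ^ (n - i) * qint (int (Suc i))) * A (Suc i))"
proof -
  have "\<iota> (qint (int (Suc n))) * (\<Sum>i\<le>Suc n. A i) =
    (\<Sum>i\<le>Suc n. \<iota> (vv powi (- int i) * qint (int (Suc n - i))) * A i) +
    (\<Sum>i\<le>Suc n. \<iota> (vv ^ (Suc n - i) * qint (int i)) * A i)"
    unfolding sum_distrib_left sum.distrib[symmetric]
  proof (rule sum.cong[OF refl])
    fix i assume "i \<in> {..Suc n}"
    then have "int (Suc n) = int i + int (Suc n - i)" by simp
    then have "qint (int (Suc n)) = vv powi (- int i) * qint (int (Suc n - i)) + vv powi int (Suc n - i) * qint (int i)"
      by (simp only: qint_add)
    then show "\<iota> (qint (int (Suc n))) * A i = \<iota> (vv powi (- int i) * qint (int (Suc n - i))) * A i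
        + \<iota> (vv ^ (Suc n - i) * qint (int i)) * A i"
      by (simp add: \<iota>_add distrib_right)
  qed
  also have "(\<Sum>i\<le>Suc n. \<iota> (vv powi (- int i) * qint (int (Suc n - i))) * A i) =
    (\<Sum>i\<le>n. \<iota> (vv powi (- int i) * qint (int (Suc n - i))) * A i)"
    by (simp add: \<iota>_0)
  also have "(\<Sum>i\<le>Suc n. \<iota> (vv ^ (Suc n - i) * qint (int i)) * A i) =
    (\<Sum>i\<le>n. \<iota> (vv ^ (n - i) * qint (int (Suc i))) * A (Suc i))"
    by (subst sum.atMost_Suc_shift) (simp add: \<iota>_0)
  finally show ?thesis by (simp add: sum.distrib)
qed

lemma power_commute_v2:
  assumes "y * x = \<iota> (vv\<^sup>2) * (x * y)"
  shows "y * x ^ p = \<iota> (vv ^ (2 * p)) * (x ^ p * y)"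
proof (induction p)
  case 0 then show ?case by (simp add: \<iota>_1)
next
  case (Suc p)
  have "y * x ^ Suc p = (y * x) * x ^ p" by (simp add: mult.assoc)
  also have "\<dots> = \<iota> (vv\<^sup>2) * (x * (y * x ^ p))" by (simp add: assms mult.assoc)
  also have "\<dots> = \<iota> (vv\<^sup>2 * vv ^ (2 * p)) * (x ^ Suc p * y)"
    by (simp only: Suc.IH \<iota>_left \<iota>_pull[of x] mult.assoc power_Suc)
  also have "vv\<^sup>2 * vv ^ (2 * p) = vv ^ (2 * Suc p)"
    by (simp add: power_add power2_eq_square)
  finally show ?case .
qed

lemma divided_power_sum:
  assumes "y * x = \<iota> (vv\<^sup>2) * (x * y)"
  shows "\<iota> (1 / qfact n) * (x + y) ^ n = (\<Sum>i\<le>n. \<iota> (coef (n - i) i) * (x ^ (n - i) * y ^ i))"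
proof (induction n)
  case 0 show ?case by (simp add: qfact_def coef_def \<iota>_1)
next
  case (Suc n)
  let ?A = "\<lambda>n i. \<iota> (coef (n - i) i) * (x ^ (n - i) * y ^ i)"
  have "\<iota> (qint (int (Suc n))) * (\<Sum>i\<le>Suc n. ?A (Suc n) i) = (\<Sum>i\<le>n. (x + y) * ?A n i)"
    unfolding split_sum
  proof (rule sum.cong[OF refl])
    fix i assume i: "i \<in> {..n}"
    then have S: "Suc n - i = Suc (n - i)" by simp
    have 1: "\<iota> (vv powi (- int i) * qint (int (Suc n - i))) * ?A (Suc n) i = x * ?A n i"
      unfolding S \<iota>_left \<iota>_pull[of x] coef_1 by (simp add: mult.assoc)
    have "y * ?A n i = \<iota> (coef (n - i) i) * ((y * x ^ (n - i)) * y ^ i)"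
      by (simp only: \<iota>_pull[of y] mult.assoc)
    also have "\<dots> = \<iota> (coef (n - i) i * vv ^ (2 * (n - i))) * (x ^ (n - i) * y ^ Suc i)"
      by (simp only: power_commute_v2[OF assms] \<iota>_left mult.assoc power_Suc)
    finally have 2: "\<iota> (vv ^ (n - i) * qint (int (Suc i))) * ?A (Suc n) (Suc i) = y * ?A n i"
      unfolding diff_Suc_Suc \<iota>_left coef_2 by simp
    show "\<iota> (vv powi (- int i) * qint (int (Suc n - i))) * ?A (Suc n) i
        + \<iota> (vv ^ (n - i) * qint (int (Suc i))) * ?A (Suc n) (Suc i) = (x + y) * ?A n i"
      unfolding 1 2 by (simp add: distrib_right)
  qed
  also have "\<dots> = (x + y) * (\<iota> (1 / qfact n) * (x + y) ^ n)"
    by (simp only: Suc.IH sum_distrib_left)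
  also have "\<dots> = \<iota> (1 / qfact n) * (x + y) ^ Suc n"
    by (simp only: \<iota>_pull[of "x + y"] power_Suc)
  also have "1 / qfact n = qint (int (Suc n)) * (1 / qfact (Suc n))"
    using qint_nz[of "Suc n"] by (simp add: qfact_Suc del: of_nat_Suc)
  finally have "\<iota> (qint (int (Suc n))) * (\<Sum>i\<le>Suc n. ?A (Suc n) i) =
      \<iota> (qint (int (Suc n))) * (\<iota> (1 / qfact (Suc n)) * (x + y) ^ Suc n)"
    by (simp only: \<iota>_left)
  from \<iota>_cancel[OF qint_nz[OF zero_less_Suc] this] show ?case by (rule sym)
qed

lemma commuting_power_mult: "y * x = x * y \<Longrightarrow> (x * y) ^ n = x ^ n * y ^ n" for x y :: 'r
proof (induction n)
  case (Suc n)
  have "x * y * (x ^ n * y ^ n) = x * (y * x ^ n) * y ^ n" by (simp add: mult.assoc)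
  also have "y * x ^ n = x ^ n * y"
    using power_commuting_commutes[of x y n] Suc.prems by simp
  finally show ?case using Suc by (simp add: mult.assoc)
qed simp

lemma coef_split: "\<iota> (coef p i) * (x * (y * z)) =
  \<iota> (vv ^ (i * p)) * ((\<iota> (1 / qfact p) * x) * y * (\<iota> (1 / qfact i) * z))"
proof -
  have "coef p i = vv ^ (i * p) * ((1 / qfact p) * (1 / qfact i))"
    by (simp add: coef_def)
  then show ?thesis
    by (simp only: \<iota>_mult mult.assoc \<iota>_pull[of x] \<iota>_pull[of y])
qed

lemma comult_Ediv:
  assumes "K1 * E1 = \<iota> (vv\<^sup>2) * (E1 * K1)" and "E2 * E1 = E1 * E2" and "E2 * K1 = K1 * E2"
  shows "\<iota> (1 / qfact n) * (E1 + K1 * E2) ^ n =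
    (\<Sum>i\<in>{0..n}. \<iota> (vv ^ (i * (n - i))) *
      ((\<iota> (1 / qfact (n - i)) * E1 ^ (n - i)) * K1 ^ i * (\<iota> (1 / qfact i) * E2 ^ i)))"
proof -
  have "K1 * E2 * E1 = K1 * E1 * E2" by (simp only: assms(2) mult.assoc)
  also have "\<dots> = \<iota> (vv\<^sup>2) * (E1 * K1) * E2" by (simp only: assms(1))
  finally have "K1 * E2 * E1 = \<iota> (vv\<^sup>2) * (E1 * (K1 * E2))" by (simp only: mult.assoc)
  from divided_power_sum[OF this, of n] show ?thesis
    by (simp only: commuting_power_mult[OF assms(3)] coef_split atLeast0AtMost)
qed

lemma comult_Fdiv:
  assumes "K2' * F2 = \<iota> (vv\<^sup>2) * (F2 * K2')" and "F2 * F1 = F1 * F2" and "K2' * F1 = F1 * K2'"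
  shows "\<iota> (1 / qfact n) * (F1 * K2' + F2) ^ n =
    (\<Sum>i\<in>{0..n}. \<iota> (vv ^ (i * (n - i))) *
      ((\<iota> (1 / qfact i) * F1 ^ i) * ((\<iota> (1 / qfact (n - i)) * F2 ^ (n - i)) * K2' ^ i)))"
proof -
  have "F1 * K2' * F2 = \<iota> (vv\<^sup>2) * (F1 * (F2 * K2'))" by (simp add: assms mult.assoc \<iota>_pull[of F1])
  also have "F1 * (F2 * K2') = F2 * (F1 * K2')" by (simp add: assms flip: mult.assoc)
  finally have "F1 * K2' * F2 = \<iota> (vv\<^sup>2) * (F2 * (F1 * K2'))" .
  from divided_power_sum[OF this, of n]
  have "\<iota> (1 / qfact n) * (F1 * K2' + F2) ^ n =
    (\<Sum>i\<in>{0..n}. \<iota> (coef (n - i) i) * (F2 ^ (n - i) * (F1 ^ i * K2' ^ i)))"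
    by (simp only: commuting_power_mult[OF assms(3)] atLeast0AtMost add.commute)
  also have "\<dots> = (\<Sum>i\<in>{0..n}. \<iota> (vv ^ (i * (n - i))) *
      ((\<iota> (1 / qfact i) * F1 ^ i) * ((\<iota> (1 / qfact (n - i)) * F2 ^ (n - i)) * K2' ^ i)))"
  proof (rule sum.cong[OF refl])
    fix i
    have "F2 ^ (n - i) * F1 ^ i = F1 ^ i * F2 ^ (n - i)"
      using assms(2) by (metis power_commuting_commutes)
    then have "F2 ^ (n - i) * (F1 ^ i * K2' ^ i) = F1 ^ i * (F2 ^ (n - i) * K2' ^ i)"
      by (metis mult.assoc)
    moreover have "coef (n - i) i = vv ^ (i * (n - i)) * ((1 / qfact i) * (1 / qfact (n - i)))"
      by (simp add: coef_def)
    ultimately show "\<iota> (coef (n - i) i) * (F2 ^ (n - i) * (F1 ^ i * K2' ^ i)) = \<iota> (vv ^ (i * (n - i))) *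
      ((\<iota> (1 / qfact i) * F1 ^ i) * ((\<iota> (1 / qfact (n - i)) * F2 ^ (n - i)) * K2' ^ i))"
      by (simp only: \<iota>_mult mult.assoc \<iota>_pull[of "F1 ^ i"])
  qed
  finally show ?thesis .
qed

lemma antipode_Ediv:
  assumes "E * K' = \<iota> (vv\<^sup>2) * (K' * E)"
  shows "(- (K' * E)) ^ n = \<iota> ((- 1) ^ n * vv ^ (n * (n - 1))) * (K' ^ n * E ^ n)"
proof (induction n)
  case 0 show ?case by (simp add: \<iota>_1)
next
  case (Suc n)
  have "(- (K' * E)) ^ Suc n = - (K' * E * (\<iota> ((- 1) ^ n * vv ^ (n * (n - 1))) * (K' ^ n * E ^ n)))"
    by (simp add: Suc)
  also have "\<dots> = - (\<iota> ((- 1) ^ n * vv ^ (n * (n - 1))) * (K' * (E * K' ^ n) * E ^ n))"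
    by (simp only: \<iota>_pull[of K'] \<iota>_pull[of E] mult.assoc)
  also have "\<dots> = - (\<iota> ((- 1) ^ n * vv ^ (n * (n - 1)) * vv ^ (2 * n)) * (K' ^ Suc n * E ^ Suc n))"
    by (simp only: power_commute_v2[OF assms] \<iota>_pull[of K'] \<iota>_left mult.assoc power_Suc)
  also have "\<dots> = \<iota> (- ((- 1) ^ n * vv ^ (n * (n - 1)) * vv ^ (2 * n))) * (K' ^ Suc n * E ^ Suc n)"
    by (simp only: \<iota>_minus mult_minus_left)
  also have "- ((- 1) ^ n * vv ^ (n * (n - 1)) * vv ^ (2 * n)) = (- 1) ^ Suc n * vv ^ (Suc n * (Suc n - 1))"
  proof -
    have "n * (n - 1) + 2 * n = Suc n * (Suc n - 1)" by (cases n) simp_all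
    then have "vv ^ (n * (n - 1)) * vv ^ (2 * n) = vv ^ (Suc n * (Suc n - 1))"
      by (metis power_add)
    then show ?thesis by (simp only: mult.assoc power_Suc mult_minus_left mult_1)
  qed
  finally show ?case .
qed

lemma antipode_Fdiv:
  assumes "F * K = \<iota> (vv\<^sup>2) * (K * F)"
  shows "(- (F * K)) ^ n = \<iota> ((- 1) ^ n * inverse vv ^ (n * (n - 1))) * (F ^ n * K ^ n)"
proof -
  have *: "F * K ^ n = \<iota> (vv ^ (2 * n)) * (K ^ n * F)" for n
    by (rule power_commute_v2[OF assms])
  have K: "K ^ n * F = \<iota> (inverse vv ^ (2 * n)) * (F * K ^ n)" for n
    unfolding * \<iota>_left by (simp add: \<iota>_1 power_mult_distrib[symmetric])
  have K': "K * F ^ n = \<iota> (inverse vv ^ (2 * n)) * (F ^ n * K)" for n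
  proof (induction n)
    case 0 show ?case by (simp add: \<iota>_1)
  next
    case (Suc n)
    have "K * F ^ Suc n = (K * F) * F ^ n" by (simp add: mult.assoc)
    also have "\<dots> = \<iota> (inverse vv ^ 2) * (F * (K * F ^ n))"
      using K[of 1] by (simp add: mult.assoc)
    also have "\<dots> = \<iota> (inverse vv ^ 2 * inverse vv ^ (2 * n)) * (F ^ Suc n * K)"
      by (simp only: Suc.IH \<iota>_pull[of F] \<iota>_left mult.assoc power_Suc)
    also have "inverse vv ^ 2 * inverse vv ^ (2 * n) = inverse vv ^ (2 * Suc n)"
      by (simp add: power_add power2_eq_square)
    finally show ?case .
  qed
  show ?thesis
  proof (induction n)
    case 0 show ?case by (simp add: \<iota>_1)
  next
    case (Suc n)
    have "(- (F * K)) ^ Suc n = - (F * K * (\<iota> ((- 1) ^ n * inverse vv ^ (n * (n - 1))) * (F ^ n * K ^ n)))"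
      by (simp add: Suc)
    also have "\<dots> = - (\<iota> ((- 1) ^ n * inverse vv ^ (n * (n - 1))) * (F * (K * F ^ n) * K ^ n))"
      by (simp only: \<iota>_pull[of F] \<iota>_pull[of K] mult.assoc)
    also have "\<dots> = - (\<iota> ((- 1) ^ n * inverse vv ^ (n * (n - 1)) * inverse vv ^ (2 * n)) * (F ^ Suc n * K ^ Suc n))"
      by (simp only: K' \<iota>_pull[of F] \<iota>_left mult.assoc power_Suc)
    also have "\<dots> = \<iota> (- ((- 1) ^ n * inverse vv ^ (n * (n - 1)) * inverse vv ^ (2 * n))) * (F ^ Suc n * K ^ Suc n)"
      by (simp only: \<iota>_minus mult_minus_left)
    also have "- ((- 1) ^ n * inverse vv ^ (n * (n - 1)) * inverse vv ^ (2 * n)) = (- 1) ^ Suc n * inverse vv ^ (Suc n * (Suc n - 1))"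
    proof -
      have "n * (n - 1) + 2 * n = Suc n * (Suc n - 1)" by (cases n) simp_all
      then have "inverse vv ^ (n * (n - 1)) * inverse vv ^ (2 * n) = inverse vv ^ (Suc n * (Suc n - 1))"
        by (metis power_add)
      then show ?thesis by (simp only: mult.assoc power_Suc mult_minus_left mult_1)
    qed
    finally show ?case .
  qed
qed

end

definition Kbinom :: "(Qv \<Rightarrow> 'r::comm_ring_1) \<Rightarrow> 'r \<Rightarrow> 'r \<Rightarrow> int \<Rightarrow> nat \<Rightarrow> 'r" where
  "Kbinom \<iota> k k' c t = (\<Prod>s=1..t. \<iota> (1 / (vv powi int s - vv powi (- int s))) *
     (\<iota> (vv powi (c - int s + 1)) * k - \<iota> (vv powi (- c + int s - 1)) * k'))"

lemma antipode_Kbin: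
  fixes \<iota> :: "Qv \<Rightarrow> 'r::comm_ring_1"
  shows "Kbinom \<iota> k' k c t = (- 1) ^ t * Kbinom \<iota> k k' (int t - 1 - c) t"
proof -
  let ?d = "\<lambda>s. \<iota> (1 / (vv powi int s - vv powi (- int s)))"
  have "(\<Prod>s=1..t. \<iota> (vv powi (c - int s + 1)) * k' - \<iota> (vv powi (- c + int s - 1)) * k) =
    (\<Prod>s=1..t. - 1 * (\<iota> (vv powi (int t - 1 - c - int s + 1)) * k - \<iota> (vv powi (- (int t - 1 - c) + int s - 1)) * k'))"
    by (rule prod.reindex_bij_witness[of _ "\<lambda>s. t + 1 - s" "\<lambda>s. t + 1 - s"])
      (auto simp: of_nat_diff algebra_simps)
  also have "\<dots> = (- 1) ^ t * (\<Prod>s=1..t. \<iota> (vv powi (int t - 1 - c - int s + 1)) * k - \<iota> (vv powi (- (int t - 1 - c) + int s - 1)) * k')"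
    by (subst prod.distrib) simp
  finally show ?thesis by (simp add: Kbinom_def prod.distrib)
qed

lemma comult_Kbin:
  fixes \<iota> :: "Qv \<Rightarrow> 'r::comm_ring_1"
  assumes \<iota>: "central_hom \<iota>"
    and inv: "k1 * k1' = 1" "k2 * k2' = 1"
  shows "Kbinom \<iota> (k1 * k2) (k1' * k2') c t = (\<Sum>i\<in>{0..t}. \<iota> (vv powi (- c * int i)) *
    ((Kbinom \<iota> k1 k1' 0 i * k1 ^ (t - i)) * (k2' ^ i * Kbinom \<iota> k2 k2' c (t - i))))"
proof (induction t)
  case 0
  interpret central_hom \<iota> by fact
  show ?case by (simp add: Kbinom_def \<iota>_1)
next
  case (Suc t)
  interpret central_hom \<iota> by fact
  define D where "D = vv - inverse vv"
  define b where "b = (\<lambda>k k' c s. \<iota> (vv powi (c - int s)) * k - \<iota> (vv powi (int s - c)) * k' :: 'r)"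
  have D: "D \<noteq> 0" using vv_diff_nz' by (simp add: D_def)
  have step: "\<iota> (qint (int (Suc t))) * Kbinom \<iota> k k' c (Suc t) = \<iota> (1 / D) * (b k k' c t * Kbinom \<iota> k k' c t)" for k k' c t
  proof -
    have "vv powi int (Suc t) - vv powi (- int (Suc t)) \<noteq> 0" by (rule vv_diff_nz) simp
    then have *: "qint (int (Suc t)) * (1 / (vv powi int (Suc t) - vv powi (- int (Suc t)))) = 1 / D"
      using D by (simp add: qint_def D_def del: of_nat_Suc)
    have "Kbinom \<iota> k k' c (Suc t) = Kbinom \<iota> k k' c t *
        (\<iota> (1 / (vv powi int (Suc t) - vv powi (- int (Suc t)))) * b k k' c t)"
    proof -
      have e: "c - int (Suc t) + 1 = c - int t" "- c + int (Suc t) - 1 = int t - c" by simp_all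
      have "1 \<le> Suc t" by simp
      show ?thesis
        unfolding Kbinom_def b_def prod.nat_ivl_Suc'[OF \<open>1 \<le> Suc t\<close>] e by (rule mult.commute)
    qed
    then have "\<iota> (qint (int (Suc t))) * Kbinom \<iota> k k' c (Suc t) =
      \<iota> (qint (int (Suc t)) * (1 / (vv powi int (Suc t) - vv powi (- int (Suc t))))) * (b k k' c t * Kbinom \<iota> k k' c t)"
      by (simp only: \<iota>_mult mult_ac)
    then show ?thesis by (simp only: *)
  qed
  let ?A = "\<lambda>t i. \<iota> (vv powi (- c * int i)) *
    ((Kbinom \<iota> k1 k1' 0 i * k1 ^ (t - i)) * (k2' ^ i * Kbinom \<iota> k2 k2' c (t - i)))"
  have "\<iota> (qint (int (Suc t))) * (\<Sum>i\<le>Suc t. ?A (Suc t) i) =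
    (\<Sum>i\<le>t. \<iota> (1 / D) * (b (k1 * k2) (k1' * k2') c t * ?A t i))"
    unfolding split_sum
  proof (rule sum.cong[OF refl])
    fix i assume "i \<in> {..t}"
    then have i: "i \<le> t" by simp
    then have S: "Suc t - i = Suc (t - i)" and ti: "int t = int i + int (t - i)" by simp_all
    let ?Z = "\<iota> (1 / D) * (\<iota> (vv powi (- c * int i)) * (Kbinom \<iota> k1 k1' 0 i * k1 ^ (t - i) * (k2' ^ i * Kbinom \<iota> k2 k2' c (t - i))))"
    have 1: "\<iota> (vv powi (- int i) * qint (int (Suc t - i))) * ?A (Suc t) i =
      ?Z * (\<iota> (vv powi (- int i)) * k1 * b k2 k2' c (t - i))"
    proof -
      have "\<iota> (vv powi (- int i) * qint (int (Suc t - i))) * ?A (Suc t) i =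
        \<iota> (vv powi (- int i)) * \<iota> (vv powi (- c * int i)) * Kbinom \<iota> k1 k1' 0 i * k1 ^ Suc (t - i) * k2' ^ i *
        (\<iota> (qint (int (Suc (t - i)))) * Kbinom \<iota> k2 k2' c (Suc (t - i)))"
        unfolding S by (simp only: \<iota>_mult mult_ac)
      also have "\<dots> = ?Z * (\<iota> (vv powi (- int i)) * k1 * b k2 k2' c (t - i))"
        unfolding step by (simp only: power_Suc mult_ac)
      finally show ?thesis .
    qed
    have 2: "\<iota> (vv ^ (t - i) * qint (int (Suc i))) * ?A (Suc t) (Suc i) =
      ?Z * (\<iota> (vv powi (int (t - i) - c)) * k2' * b k1 k1' 0 i)"
    proof -
      have v: "vv powi (- c * int (Suc i)) * vv ^ (t - i) = vv powi (- c * int i) * vv powi (int (t - i) - c)"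
        by (simp add: power_int_add[symmetric] flip: power_int_of_nat) (simp add: algebra_simps)
      have "\<iota> (vv ^ (t - i) * qint (int (Suc i))) * ?A (Suc t) (Suc i) =
        \<iota> (vv powi (- c * int (Suc i)) * vv ^ (t - i)) * k1 ^ (t - i) * k2' ^ Suc i * Kbinom \<iota> k2 k2' c (t - i) *
        (\<iota> (qint (int (Suc i))) * Kbinom \<iota> k1 k1' 0 (Suc i))"
        unfolding diff_Suc_Suc by (simp only: \<iota>_mult mult_ac)
      also have "\<dots> = ?Z * (\<iota> (vv powi (int (t - i) - c)) * k2' * b k1 k1' 0 i)"
        unfolding step v by (simp only: \<iota>_mult power_Suc mult_ac)
      finally show ?thesis .
    qed
    have 3: "\<iota> (vv powi (- int i)) * k1 * b k2 k2' c (t - i) + \<iota> (vv powi (int (t - i) - c)) * k2' * b k1 k1' 0 i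
      = b (k1 * k2) (k1' * k2') c t"
    proof -
      have *: "\<iota> (vv powi x) * \<iota> (vv powi y) = \<iota> (vv powi (x + y))" for x y
        by (simp add: power_int_add \<iota>_mult)
      have "\<iota> (vv powi (- int i)) * k1 * b k2 k2' c (t - i) + \<iota> (vv powi (int (t - i) - c)) * k2' * b k1 k1' 0 i =
        (\<iota> (vv powi (- int i)) * \<iota> (vv powi (c - int (t - i)))) * (k1 * k2)
        - (\<iota> (vv powi (- int i)) * \<iota> (vv powi (int (t - i) - c))) * (k1 * k2')
        + (\<iota> (vv powi (int (t - i) - c)) * \<iota> (vv powi (0 - int i))) * (k1 * k2')
        - (\<iota> (vv powi (int (t - i) - c)) * \<iota> (vv powi (int i - 0))) * (k1' * k2')"
        unfolding b_def by (simp add: algebra_simps)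
      also have "\<dots> = b (k1 * k2) (k1' * k2') c t"
        unfolding * b_def ti by (simp add: algebra_simps)
      finally show ?thesis .
    qed
    show "\<iota> (vv powi (- int i) * qint (int (Suc t - i))) * ?A (Suc t) i +
        \<iota> (vv ^ (t - i) * qint (int (Suc i))) * ?A (Suc t) (Suc i)
      = \<iota> (1 / D) * (b (k1 * k2) (k1' * k2') c t * ?A t i)"
      unfolding 1 2 3[symmetric] by (simp only: distrib_left distrib_right mult_ac)
  qed
  also have "\<dots> = \<iota> (1 / D) * (b (k1 * k2) (k1' * k2') c t * Kbinom \<iota> (k1 * k2) (k1' * k2') c t)"
    unfolding Suc.IH atLeast0AtMost sum_distrib_left ..
  also have "\<dots> = \<iota> (qint (int (Suc t))) * Kbinom \<iota> (k1 * k2) (k1' * k2') c (Suc t)"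
    by (simp only: step)
  finally have "\<iota> (qint (int (Suc t))) * (\<Sum>i\<le>Suc t. ?A (Suc t) i) =
    \<iota> (qint (int (Suc t))) * Kbinom \<iota> (k1 * k2) (k1' * k2') c (Suc t)" .
  from \<iota>_cancel[OF qint_nz[OF zero_less_Suc] this] show ?case
    unfolding atLeast0AtMost by (rule sym)
qed


section \<open>Modules\<close>

text \<open>A finite dimensional module over \<open>subalg q G\<close> is given in coordinates: its underlying space is
  \<open>Q(q)\<^sup>n\<close>, and \<open>act\<close> records the matrices of the generators in \<open>G\<close>; they have to extend to an
  algebra homomorphism. Values of \<open>act\<close> outside \<open>G\<close> are irrelevant. Restriction to the algebra
  generated by a subset of \<open>G\<close> leaves the record unchanged.\<close>

record qmod =
  mdim :: nat
  act :: "gen \<Rightarrow> complex mat"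

definition Mat :: "complex \<Rightarrow> nat \<Rightarrow> complex mat set" where
  "Mat q n = {A \<in> carrier_mat n n. elements_mat A \<subseteq> Qq q}"

definition Vec :: "complex \<Rightarrow> nat \<Rightarrow> complex vec set" where
  "Vec q n = {x \<in> carrier_vec n. \<forall>i<n. x $ i \<in> Qq q}"

definition is_module :: "complex \<Rightarrow> gen set \<Rightarrow> qmod \<Rightarrow> bool" where
  "is_module q G M \<longleftrightarrow>
     (\<exists>\<phi> \<in> Ring.ring_hom ((Uq q)\<lparr>carrier := subalg q G\<rparr>) (ring_mat TYPE(complex) (mdim M) ()).
        (\<forall>x \<in> subalg q G. \<phi> x \<in> Mat q (mdim M)) \<and>
        (\<forall>c \<in> Qq q. \<phi> (Uq_scalar q c) = c \<cdot>\<^sub>m 1\<^sub>m (mdim M)) \<and>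
        (\<forall>g \<in> G. \<phi> (Uq_gen q g) = act M g))"

text \<open>Commuting with the generators is the same as commuting with the whole algebra.\<close>

definition iso_over :: "complex \<Rightarrow> gen set \<Rightarrow> qmod \<Rightarrow> qmod \<Rightarrow> bool" where
  "iso_over q G M N \<longleftrightarrow> mdim M = mdim N \<and>
     (\<exists>P \<in> Mat q (mdim M). \<exists>Q \<in> Mat q (mdim M).
        P * Q = 1\<^sub>m (mdim M) \<and> Q * P = 1\<^sub>m (mdim M) \<and>
        (\<forall>g \<in> G. P * act M g = act N g * P))"

definition dsum :: "qmod list \<Rightarrow> qmod" where
  "dsum Ms = \<lparr> mdim = sum_list (map mdim Ms), act = (\<lambda>g. diag_block_mat (map (\<lambda>M. act M g) Ms)) \<rparr>"

definition copies :: "'i::linorder set \<Rightarrow> ('i \<Rightarrow> nat) \<Rightarrow> ('i \<Rightarrow> qmod) \<Rightarrow> qmod list" where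
  "copies I m Ms = concat (map (\<lambda>i. replicate (m i) (Ms i)) (sorted_list_of_set I))"

definition indecomposable :: "complex \<Rightarrow> gen set \<Rightarrow> qmod \<Rightarrow> bool" where
  "indecomposable q G M \<longleftrightarrow> is_module q G M \<and> mdim M > 0 \<and>
     \<not> (\<exists>M1 M2. is_module q G M1 \<and> is_module q G M2 \<and> mdim M1 > 0 \<and> mdim M2 > 0 \<and>
                iso_over q G M (dsum [M1, M2]))"

definition kron :: "complex mat \<Rightarrow> complex mat \<Rightarrow> complex mat" where
  "kron A B = mat (dim_row A * dim_row B) (dim_col A * dim_col B)
     (\<lambda>(i, j). A $$ (i div dim_row B, j div dim_col B) * B $$ (i mod dim_row B, j mod dim_col B))"

definition msum :: "nat \<Rightarrow> nat set \<Rightarrow> (nat \<Rightarrow> complex mat) \<Rightarrow> complex mat" where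
  "msum n I A = mat n n (\<lambda>ij. \<Sum>i\<in>I. A i $$ ij)"

text \<open>Tensor products are formed with the coproduct
  \<open>\<Delta>E = E \<otimes> 1 + K \<otimes> E\<close>, \<open>\<Delta>F = F \<otimes> K\<^sup>-\<^sup>1 + 1 \<otimes> F\<close>, \<open>\<Delta>K = K \<otimes> K\<close>. On the other generators it is
  given by \<open>comult_Ediv\<close>, \<open>comult_Fdiv\<close> and \<open>comult_Kbin\<close> above, specialized to \<open>v = q\<close>.\<close>

fun tensor_act :: "complex \<Rightarrow> qmod \<Rightarrow> qmod \<Rightarrow> gen \<Rightarrow> complex mat" where
  "tensor_act q M N Kpos = kron (act M Kpos) (act N Kpos)"
| "tensor_act q M N Kneg = kron (act M Kneg) (act N Kneg)"
| "tensor_act q M N (Ediv n) = msum (mdim M * mdim N) {0..n}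
     (\<lambda>i. q ^ (i * (n - i)) \<cdot>\<^sub>m kron (act M (Ediv (n - i)) * act M Kpos ^\<^sub>m i) (act N (Ediv i)))"
| "tensor_act q M N (Fdiv n) = msum (mdim M * mdim N) {0..n}
     (\<lambda>i. q ^ (i * (n - i)) \<cdot>\<^sub>m kron (act M (Fdiv i)) (act N (Fdiv (n - i)) * act N Kneg ^\<^sub>m i))"
| "tensor_act q M N (Kbin c t) = msum (mdim M * mdim N) {0..t}
     (\<lambda>i. q powi (- c * int i) \<cdot>\<^sub>m
        kron (act M (Kbin 0 i) * act M Kpos ^\<^sub>m (t - i)) (act N Kneg ^\<^sub>m i * act N (Kbin c (t - i))))"

definition tensor :: "complex \<Rightarrow> qmod \<Rightarrow> qmod \<Rightarrow> qmod" where
  "tensor q M N = \<lparr> mdim = mdim M * mdim N, act = tensor_act q M N \<rparr>"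

text \<open>For \<open>w = lj\<close> this is \<open>C[lj]\<close>, a module over \<open>subalg q gens_mid\<close>; for \<open>w = 0\<close> it is the trivial
  module over all of \<open>U\<^sub>q(sl\<^sub>2)\<close>.\<close>

fun weight_act :: "complex \<Rightarrow> int \<Rightarrow> gen \<Rightarrow> complex" where
  "weight_act q w Kpos = q powi w"
| "weight_act q w Kneg = q powi (- w)"
| "weight_act q w (Ediv n) = (if n = 0 then 1 else 0)"
| "weight_act q w (Fdiv n) = (if n = 0 then 1 else 0)"
| "weight_act q w (Kbin c t) = spec q (qbinom (w + c) t)"

definition weight_module :: "complex \<Rightarrow> int \<Rightarrow> qmod" where
  "weight_module q w = \<lparr> mdim = 1, act = (\<lambda>g. mat 1 1 (\<lambda>_. weight_act q w g)) \<rparr>"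

fun tensor_power :: "complex \<Rightarrow> qmod \<Rightarrow> nat \<Rightarrow> qmod" where
  "tensor_power q M 0 = weight_module q 0"
| "tensor_power q M (Suc N) = tensor q (tensor_power q M N) M"


section \<open>Weyl modules and tilting modules\<close>

text \<open>The \<open>t\<close>-th basis vector is \<open>F\<^sup>(\<^sup>t\<^sup>)x\<close>, \<open>0 \<le> t \<le> n\<close>, and the columns of the matrices are the images of
  the basis vectors. The formulas for \<open>E\<^sup>(\<^sup>s\<^sup>)\<close>, \<open>F\<^sup>(\<^sup>s\<^sup>)\<close>, \<open>[K;c,s]\<close> with general \<open>s\<close>, \<open>c\<close> are those of the
  generic Weyl module over \<open>U\<^sub>A\<close>.\<close>

fun weyl_act :: "complex \<Rightarrow> nat \<Rightarrow> gen \<Rightarrow> complex mat" where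
  "weyl_act q n Kpos = mat (n + 1) (n + 1)
     (\<lambda>(i, t). if i = t then q powi (int n - 2 * int t) else 0)"
| "weyl_act q n Kneg = mat (n + 1) (n + 1)
     (\<lambda>(i, t). if i = t then q powi (2 * int t - int n) else 0)"
| "weyl_act q n (Ediv s) = mat (n + 1) (n + 1)
     (\<lambda>(i, t). if i + s = t then spec q (qbinom (int n + int s - int t) s) else 0)"
| "weyl_act q n (Fdiv s) = mat (n + 1) (n + 1)
     (\<lambda>(i, t). if i = t + s then spec q (qbinom (int s + int t) s) else 0)"
| "weyl_act q n (Kbin c s) = mat (n + 1) (n + 1)
     (\<lambda>(i, t). if i = t then spec q (qbinom (int n - 2 * int t + c) s) else 0)"

definition weyl :: "complex \<Rightarrow> nat \<Rightarrow> qmod" where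
  "weyl q n = \<lparr> mdim = n + 1, act = weyl_act q n \<rparr>"

text \<open>The action of \<open>S(g)\<close>, by \<open>antipode_Ediv\<close>, \<open>antipode_Fdiv\<close> and \<open>antipode_Kbin\<close>.\<close>

fun antipode_act :: "complex \<Rightarrow> qmod \<Rightarrow> gen \<Rightarrow> complex mat" where
  "antipode_act q M Kpos = act M Kneg"
| "antipode_act q M Kneg = act M Kpos"
| "antipode_act q M (Ediv n) =
     ((- 1) ^ n * q ^ (n * (n - 1))) \<cdot>\<^sub>m (act M Kneg ^\<^sub>m n * act M (Ediv n))"
| "antipode_act q M (Fdiv n) =
     ((- 1) ^ n * inverse q ^ (n * (n - 1))) \<cdot>\<^sub>m (act M (Fdiv n) * act M Kpos ^\<^sub>m n)"
| "antipode_act q M (Kbin c t) = (- 1) ^ t \<cdot>\<^sub>m act M (Kbin (int t - 1 - c) t)"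

text \<open>The dual \<open>Hom(M, Q(q))\<close> with \<open>(g f)(x) = f(S(g) x)\<close>, in the dual basis.\<close>

definition dual :: "complex \<Rightarrow> qmod \<Rightarrow> qmod" where
  "dual q M = \<lparr> mdim = mdim M, act = (\<lambda>g. transpose_mat (antipode_act q M g)) \<rparr>"

definition submodule :: "complex \<Rightarrow> qmod \<Rightarrow> complex vec set \<Rightarrow> bool" where
  "submodule q M V \<longleftrightarrow> V \<subseteq> Vec q (mdim M) \<and> 0\<^sub>v (mdim M) \<in> V \<and>
     (\<forall>x\<in>V. \<forall>y\<in>V. x + y \<in> V) \<and> (\<forall>c\<in>Qq q. \<forall>x\<in>V. c \<cdot>\<^sub>v x \<in> V) \<and>
     (\<forall>g\<in>gens_big. \<forall>x\<in>V. act M g *\<^sub>v x \<in> V)"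

text \<open>For submodules \<open>A \<subseteq> B\<close> of \<open>M\<close>: the quotient \<open>B/A\<close> is isomorphic to \<open>W\<close>, as witnessed by a
  surjective homomorphism from \<open>B\<close> to \<open>W\<close> with kernel \<open>A\<close>.\<close>

definition subquotient_iso ::
  "complex \<Rightarrow> qmod \<Rightarrow> complex vec set \<Rightarrow> complex vec set \<Rightarrow> qmod \<Rightarrow> bool" where
  "subquotient_iso q M A B W \<longleftrightarrow> (\<exists>\<phi>.
     \<phi> ` B = Vec q (mdim W) \<and> {x \<in> B. \<phi> x = 0\<^sub>v (mdim W)} = A \<and>
     (\<forall>x\<in>B. \<forall>y\<in>B. \<phi> (x + y) = \<phi> x + \<phi> y) \<and> (\<forall>c\<in>Qq q. \<forall>x\<in>B. \<phi> (c \<cdot>\<^sub>v x) = c \<cdot>\<^sub>v \<phi> x) \<and>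
     (\<forall>g\<in>gens_big. \<forall>x\<in>B. \<phi> (act M g *\<^sub>v x) = act W g *\<^sub>v \<phi> x))"

definition filtration :: "complex \<Rightarrow> qmod \<Rightarrow> qmod list \<Rightarrow> bool" where
  "filtration q M Ws \<longleftrightarrow> (\<exists>V. V 0 = {0\<^sub>v (mdim M)} \<and> V (length Ws) = Vec q (mdim M) \<and>
     (\<forall>i\<le>length Ws. submodule q M (V i)) \<and>
     (\<forall>i<length Ws. V i \<subseteq> V (Suc i) \<and> subquotient_iso q M (V i) (V (Suc i)) (Ws ! i)))"

definition weyl_filtration :: "complex \<Rightarrow> qmod \<Rightarrow> nat list \<Rightarrow> bool" where
  "weyl_filtration q M ks \<longleftrightarrow> filtration q M (map (weyl q) ks)"

definition dual_weyl_filtration :: "complex \<Rightarrow> qmod \<Rightarrow> nat list \<Rightarrow> bool" where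
  "dual_weyl_filtration q M ks \<longleftrightarrow> filtration q M (map (\<lambda>k. dual q (weyl q k)) ks)"

definition tilting :: "complex \<Rightarrow> qmod \<Rightarrow> bool" where
  "tilting q M \<longleftrightarrow> is_module q gens_big M \<and>
     (\<exists>ks. weyl_filtration q M ks) \<and> (\<exists>ks. dual_weyl_filtration q M ks)"

text \<open>\<open>M\<close> is a model of \<open>T(k)\<close>, which is only defined up to isomorphism.\<close>

definition is_T :: "complex \<Rightarrow> nat \<Rightarrow> qmod \<Rightarrow> bool" where
  "is_T q k M \<longleftrightarrow> indecomposable q gens_big M \<and> tilting q M \<and>
     (\<exists>ks. weyl_filtration q M ks \<and> count_list ks k = 1 \<and> (\<forall>k'>k. k' \<notin> set ks))"


section \<open>Multiplicities\<close>

text \<open>The multiplicity of the indecomposable module \<open>W\<close> in a decomposition of \<open>M\<close> into indecomposable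
  \<open>U\<^sub>q(sl\<^sub>2)\<close>-modules; it does not depend on the decomposition by the Krull-Schmidt theorem.\<close>

definition multiplicity_in :: "complex \<Rightarrow> qmod \<Rightarrow> qmod \<Rightarrow> nat" where
  "multiplicity_in q W M = (THE c. \<exists>Ws. (\<forall>W'\<in>set Ws. indecomposable q gens_big W') \<and>
     iso_over q gens_big M (dsum Ws) \<and> c = length (filter (iso_over q gens_big W) Ws))"

definition tilting_mult :: "complex \<Rightarrow> (nat \<Rightarrow> qmod) \<Rightarrow> nat \<Rightarrow> nat \<Rightarrow> nat" where
  "tilting_mult q T N k = multiplicity_in q (T k) (tensor_power q (T 1) N)"

text \<open>The decomposition of \<open>T(1)\<^sup>\<otimes>\<^sup>N\<close> over \<open>u\<^sub>q\<^sup>- U\<^sub>q\<^sup>0 u\<^sub>q\<^sup>+\<close>, by which the multiplicities \<open>m k j\<close> of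
  \<open>C[lj] \<otimes> T(k)\<close>, \<open>l-1 \<le> k \<le> 2l-2\<close>, are defined. Since all modules are finite dimensional, only
  finitely many of them are nonzero.\<close>

definition mid_multiplicities ::
  "complex \<Rightarrow> nat \<Rightarrow> (nat \<Rightarrow> qmod) \<Rightarrow> nat \<Rightarrow> (nat \<Rightarrow> int \<Rightarrow> nat) \<Rightarrow> bool" where
  "mid_multiplicities q l T N m \<longleftrightarrow>
     (\<forall>k\<in>{l-1..2*l-2}. finite {j. m k j \<noteq> 0}) \<and>
     iso_over q gens_mid (tensor_power q (T 1) N)
       (dsum (copies {0..l-2} (tilting_mult q T N) T
          @ copies {j. m (l-1) j \<noteq> 0} (m (l-1)) (\<lambda>j. tensor q (weight_module q (int l * j)) (T (l-1)))
          @ concat (map (\<lambda>k0. copies {j. m (l+k0) j \<noteq> 0} (m (l+k0))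
                                (\<lambda>j. tensor q (weight_module q (int l * j)) (T (l+k0)))) [0..<l-1])))"

definition mult_plus :: "(nat \<Rightarrow> int \<Rightarrow> nat) \<Rightarrow> nat \<Rightarrow> nat" where
  "mult_plus m k = (\<Sum>j | even j \<and> m k j \<noteq> 0. m k j)"

definition mult_minus :: "(nat \<Rightarrow> int \<Rightarrow> nat) \<Rightarrow> nat \<Rightarrow> nat" where
  "mult_minus m k = (\<Sum>j | odd j \<and> m k j \<noteq> 0. m k j)"

text \<open>\<open>T\<^sub>+(k)\<close> is the restriction of \<open>T(k)\<close> to \<open>u\<^sub>q(sl\<^sub>2)\<close>. The restriction of \<open>C[lj] \<otimes> T(k)\<close> is the same
  for all odd \<open>j\<close>; \<open>j = 1\<close> is taken to define \<open>T\<^sub>-(k)\<close>.\<close>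

definition T_plus :: "(nat \<Rightarrow> qmod) \<Rightarrow> nat \<Rightarrow> qmod" where
  "T_plus T k = T k"

definition T_minus :: "complex \<Rightarrow> nat \<Rightarrow> (nat \<Rightarrow> qmod) \<Rightarrow> nat \<Rightarrow> qmod" where
  "T_minus q l T k = tensor q (weight_module q (int l)) (T k)"

end

theory Submission
  imports Defs "HOL-Library.Multiset"
begin

text \<open>Restricting the given decomposition over \<open>u\<^sub>q\<^sup>- U\<^sub>q\<^sup>0 u\<^sub>q\<^sup>+\<close> to the small quantum group forgets the
  operators \<open>[K;c,t]\<close>. On \<open>C[lj]\<close> the remaining generators act through \<open>q\<^sup>l\<^sup>j = (-1)\<^sup>j\<close>, so that
  \<open>C[lj] \<otimes> T(k)\<close> only depends on the parity of \<open>j\<close>. Collecting the summands of equal parity adds up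
  the multiplicities.\<close>

text \<open>Only sizes are recorded, which is all that the matrix algebra below requires. Tensor
  products and direct sums thus never have to be shown to be modules.\<close>

definition well_formed :: "gen set \<Rightarrow> qmod \<Rightarrow> bool" where
  "well_formed G M \<longleftrightarrow> (\<forall>g\<in>G. act M g \<in> carrier_mat (mdim M) (mdim M))"

text \<open>Coarser than equality of records: restriction leaves a record unchanged, so two modules
  with the same restriction to \<open>G\<close> may still differ on the other generators.\<close>

definition agree_on :: "gen set \<Rightarrow> qmod \<Rightarrow> qmod \<Rightarrow> bool" where
  "agree_on G M N \<longleftrightarrow> mdim M = mdim N \<and> (\<forall>g\<in>G. act M g = act N g)"

section \<open>Direct sums up to isomorphism\<close>

lemma well_formed_carrier:
  "well_formed G M \<Longrightarrow> g \<in> G \<Longrightarrow> act M g \<in> carrier_mat (mdim M) (mdim M)"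
  by (simp add: well_formed_def)

section \<open>Matrices with entries in Q(q)\<close>

lemma Mat_carrier: "A \<in> Mat q n \<Longrightarrow> A \<in> carrier_mat n n"
  by (simp add: Mat_def)

lemma Mat_iff: "A \<in> Mat q n \<longleftrightarrow> A \<in> carrier_mat n n \<and> (\<forall>i<n. \<forall>j<n. A $$ (i, j) \<in> Qq q)"
  unfolding Mat_def by fastforce

lemma Qq_sum: "(\<And>i. i \<in> I \<Longrightarrow> f i \<in> Qq q) \<Longrightarrow> sum f I \<in> Qq q"
  by (induction I rule: infinite_finite_induct) (auto intro: Qq_closed)

lemma Mat_mult: "A \<in> Mat q n \<Longrightarrow> B \<in> Mat q n \<Longrightarrow> A * B \<in> Mat q n"
  by (auto simp: Mat_iff scalar_prod_def intro!: Qq_sum Qq_closed)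

lemma Mat_one: "1\<^sub>m n \<in> Mat q n"
  by (auto simp: Mat_iff intro: Qq_closed)

lemma Mat_four_block:
  assumes "A \<in> Mat q m" "D \<in> Mat q n"
  shows "four_block_mat A (0\<^sub>m m n) (0\<^sub>m n m) D \<in> Mat q (m + n)"
  using assms by (auto simp: Mat_iff intro: Qq_closed)

section \<open>Reflexivity, restriction and transitivity of isomorphism\<close>

lemma iso_over_refl: "well_formed G M \<Longrightarrow> iso_over q G M M"
  unfolding iso_over_def well_formed_def
  by (auto intro!: bexI[of _ "1\<^sub>m (mdim M)"] Mat_one)

lemma iso_over_agree: "agree_on G M N \<Longrightarrow> well_formed G M \<Longrightarrow> iso_over q G M N"
  using iso_over_refl[of G M q] unfolding iso_over_def agree_on_def by auto

lemma iso_over_mono: "iso_over q G M N \<Longrightarrow> H \<subseteq> G \<Longrightarrow> iso_over q H M N"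
  unfolding iso_over_def by blast

text \<open>Intertwiners compose. The sizes are assumed because \<open>iso_over\<close> does not
  enforce them, while associativity of matrix products requires them.\<close>

lemma iso_over_trans:
  assumes wf: "well_formed G L" "well_formed G M" "well_formed G N"
    and "iso_over q G L M" "iso_over q G M N"
  shows "iso_over q G L N"
proof -
  define n where "n = mdim L"
  have dims: "mdim L = n" "mdim M = n" "mdim N = n"
    using assms by (simp_all add: n_def iso_over_def)
  obtain P P' where P: "P \<in> Mat q n" "P' \<in> Mat q n" "P * P' = 1\<^sub>m n" "P' * P = 1\<^sub>m n"
      "\<And>g. g \<in> G \<Longrightarrow> P * act L g = act M g * P"
    using assms(4) unfolding iso_over_def dims by blast
  obtain R R' where R: "R \<in> Mat q n" "R' \<in> Mat q n" "R * R' = 1\<^sub>m n" "R' * R = 1\<^sub>m n"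
      "\<And>g. g \<in> G \<Longrightarrow> R * act M g = act N g * R"
    using assms(5) unfolding iso_over_def dims by blast
  note c = P(1,2)[THEN Mat_carrier] R(1,2)[THEN Mat_carrier]
  \<comment> \<open>Applied twice, to show that \<open>P' * R'\<close> is a right and a left inverse
    of \<open>R * P\<close>.\<close>
  have inv: "(A * B) * (B' * A') = 1\<^sub>m n"
    if "A \<in> carrier_mat n n" "B \<in> carrier_mat n n" "A' \<in> carrier_mat n n" "B' \<in> carrier_mat n n"
      "B * B' = 1\<^sub>m n" "A * A' = 1\<^sub>m n" for A B A' B' :: "complex mat"
  proof -
    have "(A * B) * (B' * A') = A * ((B * B') * A')"
      using that(1-4) by (simp add: assoc_mult_mat[of _ n n _ n _ n])
    then show ?thesis using that by simp
  qed
  have "(R * P) * act L g = act N g * (R * P)" if g: "g \<in> G" for g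
  proof -
    note a = well_formed_carrier[OF wf(1) g, unfolded dims] well_formed_carrier[OF wf(2) g, unfolded dims]
      well_formed_carrier[OF wf(3) g, unfolded dims]
    have "(R * P) * act L g = R * (act M g * P)"
      using a c P(5)[OF g] by (simp add: assoc_mult_mat[of _ n n _ n _ n])
    also have "\<dots> = (act N g * R) * P"
      unfolding R(5)[OF g, symmetric] by (rule assoc_mult_mat[symmetric]) (use a c in auto)
    also have "\<dots> = act N g * (R * P)" using a c by simp
    finally show ?thesis .
  qed
  then show ?thesis
    unfolding iso_over_def dims
    using inv[OF c(3,1,4,2) P(3) R(3)] inv[OF c(2,4,1,3) R(4) P(4)] Mat_mult[OF R(1) P(1)] Mat_mult[OF P(2) R(2)]
    by auto
qed

section \<open>Block diagonal sums of two modules\<close>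

lemma mdim_dsum_pair [simp]: "mdim (dsum [M, N]) = mdim M + mdim N"
  by (simp add: dsum_def)

lemma diag_block_mat_pair: "diag_block_mat [A, B] =
  four_block_mat A (0\<^sub>m (dim_row A) (dim_col B)) (0\<^sub>m (dim_row B) (dim_col A)) B"
  by (simp only: diag_block_mat.simps(2)[of A "[B]"] diag_block_mat_singleton Let_def)

lemma act_dsum_pair:
  assumes "act M g \<in> carrier_mat (mdim M) (mdim M)" "act N g \<in> carrier_mat (mdim N) (mdim N)"
  shows "act (dsum [M, N]) g =
    four_block_mat (act M g) (0\<^sub>m (mdim M) (mdim N)) (0\<^sub>m (mdim N) (mdim M)) (act N g)"
  using assms by (auto simp: dsum_def diag_block_mat_pair simp del: diag_block_mat.simps)

lemma well_formed_dsum: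
  assumes "\<And>M. M \<in> set Ms \<Longrightarrow> well_formed G M"
  shows "well_formed G (dsum Ms)"
  unfolding well_formed_def
proof
  fix g assume "g \<in> G"
  then have "dim_row (act M g) = mdim M \<and> dim_col (act M g) = mdim M" if "M \<in> set Ms" for M
    using assms[OF that] by (auto simp: well_formed_def)
  then have "map (\<lambda>M. dim_row (act M g)) Ms = map mdim Ms" "map (\<lambda>M. dim_col (act M g)) Ms = map mdim Ms"
    by simp_all
  then show "act (dsum Ms) g \<in> carrier_mat (mdim (dsum Ms)) (mdim (dsum Ms))"
    by (intro carrier_matI) (simp_all add: dsum_def dim_diag_block_mat comp_def cong: map_cong)
qed

text \<open>An equality of records and not just an isomorphism: forming block diagonal matrices is
  strictly associative. Statements on lists thereby reduce to sums of two modules.\<close>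

lemma dsum_append: "dsum (Ms @ Ns) = dsum [dsum Ms, dsum Ns]"
  by (simp add: dsum_def diag_block_mat_append diag_block_mat_pair Let_def del: diag_block_mat.simps)

lemma dsum_Cons: "dsum (M # Ns) = dsum [M, dsum Ns]"
  by (simp add: dsum_def diag_block_mat_pair del: diag_block_mat.simps(2))
    (simp add: Let_def)

lemma iso_over_dsum_pair:
  assumes wf: "well_formed G M" "well_formed G N" "well_formed G M'" "well_formed G N'"
    and "iso_over q G M M'" "iso_over q G N N'"
  shows "iso_over q G (dsum [M, N]) (dsum [M', N'])"
proof -
  define m n where "m = mdim M" and "n = mdim N"
  have dims: "mdim M = m" "mdim M' = m" "mdim N = n" "mdim N' = n"
    using assms by (simp_all add: m_def n_def iso_over_def)
  obtain P P' where P: "P \<in> Mat q m" "P' \<in> Mat q m" "P * P' = 1\<^sub>m m" "P' * P = 1\<^sub>m m"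
      "\<And>g. g \<in> G \<Longrightarrow> P * act M g = act M' g * P"
    using assms(5) unfolding iso_over_def dims by blast
  obtain R R' where R: "R \<in> Mat q n" "R' \<in> Mat q n" "R * R' = 1\<^sub>m n" "R' * R = 1\<^sub>m n"
      "\<And>g. g \<in> G \<Longrightarrow> R * act N g = act N' g * R"
    using assms(6) unfolding iso_over_def dims by blast
  note c = P(1,2)[THEN Mat_carrier] R(1,2)[THEN Mat_carrier]
  let ?D = "\<lambda>A B. four_block_mat A (0\<^sub>m m n) (0\<^sub>m n m) B :: complex mat"
  have mult: "?D A B * ?D A' B' = ?D (A * A') (B * B')"
    if "A \<in> carrier_mat m m" "B \<in> carrier_mat n n" "A' \<in> carrier_mat m m" "B' \<in> carrier_mat n n"
    for A B A' B'
    by (subst mult_four_block_mat[OF that(1) _ _ that(2,3) _ _ that(4)]) (use that in auto)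
  have "?D P R * act (dsum [M, N]) g = act (dsum [M', N']) g * ?D P R" if g: "g \<in> G" for g
  proof -
    note a = wf[THEN well_formed_carrier, OF g, unfolded dims]
    have "act (dsum [M, N]) g = ?D (act M g) (act N g)" "act (dsum [M', N']) g = ?D (act M' g) (act N' g)"
      using act_dsum_pair[of M g N] act_dsum_pair[of M' g N'] a by (simp_all add: dims)
    then show ?thesis using a c by (simp add: mult P(5)[OF g] R(5)[OF g])
  qed
  moreover have "?D P R * ?D P' R' = 1\<^sub>m (m + n)" "?D P' R' * ?D P R = 1\<^sub>m (m + n)"
    using c by (simp_all add: mult P R)
  ultimately show ?thesis
    unfolding iso_over_def mdim_dsum_pair dims
    using Mat_four_block[OF P(1) R(1)] Mat_four_block[OF P(2) R(2)] by blast
qed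

lemma iso_over_dsum_swap:
  assumes wf: "well_formed G M" "well_formed G N"
  shows "iso_over q G (dsum [M, N]) (dsum [N, M])"
proof -
  define m n where "m = mdim M" and "n = mdim N"
  \<comment> \<open>The block permutation matrix that sends coordinates (x, y), of lengths
    \<open>m\<close> and \<open>n\<close>, to (y, x). Its inverse is \<open>?S n m\<close>.\<close>
  let ?S = "\<lambda>m n. four_block_mat (0\<^sub>m n m) (1\<^sub>m n) (1\<^sub>m m) (0\<^sub>m m n) :: complex mat"
  have S: "?S m n \<in> Mat q (m + n)" for m n
    by (auto simp: Mat_iff intro: Qq_closed)
  have inv: "?S n m * ?S m n = 1\<^sub>m (m + n)" for m n
    by (subst mult_four_block_mat[of _ m n _ m _ n _ _ m _ n]) auto
  have "?S m n * act (dsum [M, N]) g = act (dsum [N, M]) g * ?S m n" if g: "g \<in> G" for g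
  proof -
    note a = wf[THEN well_formed_carrier, OF g, folded m_def n_def]
    have e: "act (dsum [M, N]) g = four_block_mat (act M g) (0\<^sub>m m n) (0\<^sub>m n m) (act N g)"
      "act (dsum [N, M]) g = four_block_mat (act N g) (0\<^sub>m n m) (0\<^sub>m m n) (act M g)"
      using act_dsum_pair[of M g N] act_dsum_pair[of N g M] a by (simp_all add: m_def n_def)
    have "?S m n * act (dsum [M, N]) g = four_block_mat (0\<^sub>m n m) (act N g) (act M g) (0\<^sub>m m n)"
      unfolding e by (subst mult_four_block_mat[of _ n m _ n _ m _ _ m _ n]) (use a in auto)
    also have "\<dots> = act (dsum [N, M]) g * ?S m n"
      unfolding e by (subst mult_four_block_mat[of _ n n _ m _ m _ _ m _ n]) (use a in auto)
    finally show ?thesis .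
  qed
  then show ?thesis
    unfolding iso_over_def mdim_dsum_pair m_def[symmetric] n_def[symmetric]
    using S[of m n] S[of n m] inv[of m n] inv[of n m] by (auto simp: add.commute)
qed

text \<open>The head \<open>M\<close> occurs in \<open>Ns = As @ M # Bs\<close>. The induction
  hypothesis turns the tail into \<open>As @ Bs\<close>, and swapping \<open>M\<close> with the
  single block \<open>dsum As\<close> brings it to its place.\<close>

lemma iso_over_dsum_mset:
  assumes "mset Ms = mset Ns" "\<And>M. M \<in> set Ms \<Longrightarrow> well_formed G M"
  shows "iso_over q G (dsum Ms) (dsum Ns)"
  using assms
proof (induction Ms arbitrary: Ns)
  case Nil
  then show ?case by (auto intro!: iso_over_refl well_formed_dsum)
next
  case (Cons M Ms)
  from Cons.prems(1) have "M \<in> set Ns" by (metis list.set_intros(1) set_mset_mset)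
  then obtain As Bs where Ns: "Ns = As @ M # Bs" by (meson split_list)
  have ms: "mset Ms = mset (As @ Bs)" using Cons.prems(1) by (simp add: Ns)
  then have set: "set Ms = set As \<union> set Bs" by (metis set_append mset_eq_setD)
  have wf: "well_formed G M" "well_formed G (dsum Ms)" "well_formed G (dsum As)" "well_formed G (dsum Bs)"
      "well_formed G (dsum (As @ Bs))" "well_formed G (dsum (M # As))" "well_formed G (dsum (As @ [M]))"
      "well_formed G (dsum (M # Ms))" "well_formed G (dsum (M # As @ Bs))" "well_formed G (dsum Ns)"
      "well_formed G (dsum [M])"
    using Cons.prems(2) set by (auto simp: Ns intro!: well_formed_dsum)
  have 1: "iso_over q G (dsum (M # Ms)) (dsum (M # As @ Bs))"
    unfolding dsum_Cons[of M Ms] dsum_Cons[of M "As @ Bs"]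
    using Cons.IH[OF ms] Cons.prems(2) wf
    by (intro iso_over_dsum_pair iso_over_refl) auto
  have "iso_over q G (dsum (M # As)) (dsum (As @ [M]))"
    using iso_over_dsum_swap[OF wf(11,3)] dsum_append[of "[M]" As] dsum_append[of As "[M]"] by simp
  then have "iso_over q G (dsum [dsum (M # As), dsum Bs]) (dsum [dsum (As @ [M]), dsum Bs])"
    using wf by (intro iso_over_dsum_pair iso_over_refl) auto
  then have 2: "iso_over q G (dsum (M # As @ Bs)) (dsum Ns)"
    by (simp add: Ns flip: dsum_append)
  show ?case by (rule iso_over_trans[OF wf(8-10) 1 2])
qed

section \<open>Lists of summands, entry by entry and as multisets\<close>

lemma agree_on_dsum:
  assumes "list_all2 (agree_on G) Ms Ns"
  shows "agree_on G (dsum Ms) (dsum Ns)"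
proof -
  have "map mdim Ms = map mdim Ns" and "map (\<lambda>M. act M g) Ms = map (\<lambda>M. act M g) Ns" if "g \<in> G" for g
    using assms that by (induction rule: list_all2_induct) (auto simp: agree_on_def)
  moreover have "map mdim Ms = map mdim Ns"
    using assms by (induction rule: list_all2_induct) (auto simp: agree_on_def)
  ultimately show ?thesis by (simp add: agree_on_def dsum_def)
qed

lemma set_copies: "finite I \<Longrightarrow> set (copies I m Ms) = Ms ` {i \<in> I. m i \<noteq> 0}"
  by (auto simp: copies_def)

text \<open>Regrouping summands becomes a manipulation of finite sums, free of the order of the
  index set.\<close>

lemma mset_copies: "finite I \<Longrightarrow> mset (copies I m Ms) = (\<Sum>i\<in>I. replicate_mset (m i) (Ms i))"
proof -
  assume I: "finite I"
  have "mset (copies I m Ms) = (\<Sum>i\<leftarrow>sorted_list_of_set I. replicate_mset (m i) (Ms i))"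
    by (simp add: copies_def mset_concat comp_def)
  with I show ?thesis by (simp add: sum_list_distinct_conv_sum_set)
qed

lemma list_all2_agree_on_copies:
  assumes "\<And>i. i \<in> I \<Longrightarrow> agree_on G (Ms i) (Ns i)" "finite I"
  shows "list_all2 (agree_on G) (copies I m Ms) (copies I m Ns)"
proof -
  \<comment> \<open>Stated for an arbitrary list of indices, to allow induction; the sorted
    enumeration of \<open>I\<close> is the case of interest.\<close>
  have "list_all2 (agree_on G) (concat (map (\<lambda>i. replicate (m i) (Ms i)) js))
      (concat (map (\<lambda>i. replicate (m i) (Ns i)) js))" if "set js \<subseteq> I" for js
    using that
  proof (induction js)
    case (Cons i js)
    then have "list_all2 (agree_on G) (replicate (m i) (Ms i)) (replicate (m i) (Ns i))"
      using assms(1)[of i] by (simp add: list_all2_conv_all_nth)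
    with Cons show ?case by (auto intro!: list_all2_appendI)
  qed simp
  then show ?thesis using assms(2) by (simp add: copies_def)
qed

lemma list_all2_agree_on_refl: "list_all2 (agree_on G) Ms Ms"
  by (simp add: agree_on_def list_all2_refl)

text \<open>The sum over \<open>j\<close> splits by parity. On each class the module is constant, so
  its multiplicities add up.\<close>

lemma mset_copies_parity:
  fixes m :: "nat \<Rightarrow> int \<Rightarrow> nat"
  assumes "finite {j. m k j \<noteq> 0}"
  shows "mset (copies {j. m k j \<noteq> 0} (m k) (\<lambda>j. if even j then A else B)) =
    replicate_mset (mult_plus m k) A + replicate_mset (mult_minus m k) B"
proof -
  have rep: "(\<Sum>j\<in>J. replicate_mset (f j) M) = replicate_mset (sum f J) M"
    for f :: "int \<Rightarrow> nat" and J M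
    by (simp add: multiset_eq_iff count_sum)
  let ?J = "{j. m k j \<noteq> 0}"
  have J: "?J \<inter> {j. even j} = {j. even j \<and> m k j \<noteq> 0}" "?J \<inter> - {j. even j} = {j. odd j \<and> m k j \<noteq> 0}"
    by auto
  have "mset (copies ?J (m k) (\<lambda>j. if even j then A else B)) =
      (\<Sum>j\<in>?J. if even j then replicate_mset (m k j) A else replicate_mset (m k j) B)"
    using assms by (simp add: mset_copies if_distrib cong: if_cong)
  also have "\<dots> = (\<Sum>j\<in>?J \<inter> {j. even j}. replicate_mset (m k j) A) + (\<Sum>j\<in>?J \<inter> - {j. even j}. replicate_mset (m k j) B)"
    using assms by (rule sum.If_cases)
  finally show ?thesis unfolding rep J mult_plus_def mult_minus_def .
qed

section \<open>Tensor products\<close>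

lemma kron_carrier:
  "A \<in> carrier_mat m m \<Longrightarrow> B \<in> carrier_mat n n \<Longrightarrow> kron A B \<in> carrier_mat (m * n) (m * n)"
  by (simp add: kron_def)

text \<open>All generators are taken because the coproduct leaves smaller sets: that of
  \<open>Ediv 1\<close> involves \<open>Ediv 0\<close>, which is not in
  \<open>gens_small\<close>.\<close>

lemma well_formed_tensor:
  assumes "well_formed UNIV M" "well_formed UNIV N"
  shows "well_formed UNIV (tensor q M N)"
proof -
  have "tensor_act q M N g \<in> carrier_mat (mdim M * mdim N) (mdim M * mdim N)" for g
    using assms by (cases g) (auto simp: msum_def well_formed_def kron_carrier)
  then show ?thesis by (simp add: well_formed_def tensor_def)
qed

lemma well_formed_weight_module: "well_formed UNIV (weight_module q w)"
  by (simp add: well_formed_def weight_module_def)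

lemma well_formed_tensor_power: "well_formed UNIV M \<Longrightarrow> well_formed UNIV (tensor_power q M N)"
  by (induction N) (auto intro: well_formed_tensor well_formed_weight_module)

lemma well_formed_subset: "well_formed G M \<Longrightarrow> H \<subseteq> G \<Longrightarrow> well_formed H M"
  by (auto simp: well_formed_def)

lemma is_module_well_formed: "is_module q G M \<Longrightarrow> well_formed G M"
  unfolding is_module_def well_formed_def by (metis Mat_carrier subalg.intros(1))

section \<open>Tensoring with a one-dimensional module\<close>

lemma kron_scalar: "A \<in> carrier_mat 1 1 \<Longrightarrow> B \<in> carrier_mat n n \<Longrightarrow> kron A B = (A $$ (0, 0)) \<cdot>\<^sub>m B"
  by (rule eq_matI) (auto simp: kron_def)

text \<open>The sign also occurs in the action of \<open>E\<close>, because of the summand \<open>K \<otimes> E\<close> of its coproduct.\<close>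

lemma tensor_weight_small:
  assumes "well_formed UNIV M"
  shows "act (tensor q (weight_module q w) M) Kpos = q powi w \<cdot>\<^sub>m act M Kpos"
    and "act (tensor q (weight_module q w) M) Kneg = q powi (- w) \<cdot>\<^sub>m act M Kneg"
    and "act (tensor q (weight_module q w) M) (Ediv 1) = q powi w \<cdot>\<^sub>m act M (Ediv 1)"
    and "act (tensor q (weight_module q w) M) (Fdiv 1) = act M (Fdiv 1)"
proof -
  define n where "n = mdim M"
  have c: "act M g \<in> carrier_mat n n" for g using assms by (simp add: well_formed_def n_def)
  have dim: "dim_row (act M g) = n" "dim_col (act M g) = n" for g using c[of g] by auto
  \<comment> \<open>The coproducts of E and F have two terms each. As E and F vanish on the
    one-dimensional module, the term with \<open>Ediv 0\<close> or \<open>Fdiv 0\<close> on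
    \<open>M\<close>, of whose action only the size is known, drops out.\<close>
  have I: "{0..Suc 0} = {0, 1}" by auto
  have W: "mat 1 1 (\<lambda>_. x) * mat 1 1 (\<lambda>_. y) = mat 1 1 (\<lambda>_. x * y)" for x y :: complex
    by (rule eq_matI) (auto simp: scalar_prod_def)
  have P: "mat 1 1 (\<lambda>_. x) ^\<^sub>m 1 = mat 1 1 (\<lambda>_. x)" "mat 1 1 (\<lambda>_. x) ^\<^sub>m 0 = mat 1 1 (\<lambda>_. 1)" for x :: complex
    by (auto intro!: eq_matI)
  show "act (tensor q (weight_module q w) M) Kpos = q powi w \<cdot>\<^sub>m act M Kpos"
    "act (tensor q (weight_module q w) M) Kneg = q powi (- w) \<cdot>\<^sub>m act M Kneg"
    by (simp_all add: tensor_def weight_module_def kron_scalar[OF _ c])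
  show "act (tensor q (weight_module q w) M) (Ediv 1) = q powi w \<cdot>\<^sub>m act M (Ediv 1)"
    by (rule eq_matI)
      (auto simp: tensor_def weight_module_def msum_def I dim W[simplified] P[simplified] kron_def scalar_prod_def if_distrib cong: if_cong simp flip: n_def)
  show "act (tensor q (weight_module q w) M) (Fdiv 1) = act M (Fdiv 1)"
    by (rule eq_matI)
      (auto simp: tensor_def weight_module_def msum_def I dim W[simplified] P[simplified] kron_def scalar_prod_def if_distrib cong: if_cong simp flip: n_def)
qed

lemma mdim_tensor_weight [simp]: "mdim (tensor q (weight_module q w) M) = mdim M"
  by (simp add: tensor_def weight_module_def)

text \<open>The weight enters only through the scalar of \<open>Kpos\<close> and its inverse, the
  scalar of \<open>Kneg\<close>.\<close>

lemma agree_on_tensor_weight: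
  assumes "well_formed UNIV M" "q powi w = q powi w'"
  shows "agree_on gens_small (tensor q (weight_module q w) M) (tensor q (weight_module q w') M)"
  using assms
  by (auto simp: agree_on_def gens_small_def power_int_minus
      tensor_weight_small[unfolded One_nat_def])

text \<open>Serves even \<open>j\<close>, where the target \<open>T_plus\<close> is
  \<open>T k\<close> itself, with no one-dimensional factor.\<close>

lemma agree_on_tensor_weight_trivial:
  assumes "well_formed UNIV M" "q powi w = 1"
  shows "agree_on gens_small (tensor q (weight_module q w) M) M"
  using assms
  by (auto simp: agree_on_def gens_small_def power_int_minus
      tensor_weight_small[unfolded One_nat_def])

section \<open>Powers of a primitive 2l-th root of unity\<close>

lemma primitive_root_half:
  assumes "primitive_root_of_unity (2 * l) q"
  shows "q ^ l = - 1"
proof -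
  have l: "l > 0" and "q ^ (2 * l) = 1" and ne: "\<And>m. 0 < m \<Longrightarrow> m < 2 * l \<Longrightarrow> q ^ m \<noteq> 1"
    using assms by (auto simp: primitive_root_of_unity_def)
  then have "(q ^ l)\<^sup>2 = 1" by (simp add: mult.commute flip: power_mult)
  \<comment> \<open>A square root of 1 is 1 or -1, and primitivity excludes 1.\<close>
  then show ?thesis using ne[of l] l by (auto simp: power2_eq_1_iff)
qed

lemma primitive_root_powi:
  assumes "primitive_root_of_unity (2 * l) q"
  shows "q powi (int l * j) = (if even j then 1 else - 1)"
  using primitive_root_half[OF assms] by (simp add: power_int_mult power_int_minus_left)

section \<open>Regrouping the summands by parity\<close>

theorem theorem4p3:
  fixes l N :: nat and a :: int and q :: complex
    and T :: "nat \<Rightarrow> qmod" and m :: "nat \<Rightarrow> int \<Rightarrow> nat"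
  assumes "l \<ge> 3" and "odd l" and "coprime a (int l)"
    and "q = exp (complex_of_real pi * \<i> * of_int a / of_nat l)"
    and "primitive_root_of_unity (2 * l) q"
    and "\<And>k. is_T q k (T k)"
    and "mid_multiplicities q l T N m"
  shows "iso_over q gens_small (tensor_power q (T 1) N)
    (dsum (copies {0..l-2} (tilting_mult q T N) T
       @ replicate (mult_plus m (l-1)) (T_plus T (l-1))
       @ replicate (mult_minus m (l-1)) (T_minus q l T (l-1))
       @ copies {0..l-2} (\<lambda>k0. mult_plus m (l+k0)) (\<lambda>k0. T_plus T (l+k0))
       @ copies {0..l-2} (\<lambda>k0. mult_minus m (l+k0)) (\<lambda>k0. T_minus q l T (l+k0))))"
proof -
  let ?X = "\<lambda>k j. tensor q (weight_module q (int l * j)) (T k)"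
  let ?Y = "\<lambda>k j. if even j then T_plus T k else T_minus q l T k"
  let ?J = "\<lambda>k. {j. m k j \<noteq> 0}"
  \<comment> \<open>The given list of summands, with the family \<open>C\<close> as a parameter so
    that \<open>?X\<close> can be exchanged for \<open>?Y\<close> in place.\<close>
  define Z where "Z C = copies {0..l-2} (tilting_mult q T N) T
       @ copies (?J (l-1)) (m (l-1)) (C (l-1))
       @ concat (map (\<lambda>k0. copies (?J (l+k0)) (m (l+k0)) (C (l+k0))) [0..<l-1])"
    for C :: "nat \<Rightarrow> int \<Rightarrow> qmod"
  define R where "R = copies {0..l-2} (tilting_mult q T N) T
       @ replicate (mult_plus m (l-1)) (T_plus T (l-1))
       @ replicate (mult_minus m (l-1)) (T_minus q l T (l-1))
       @ copies {0..l-2} (\<lambda>k0. mult_plus m (l+k0)) (\<lambda>k0. T_plus T (l+k0))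
       @ copies {0..l-2} (\<lambda>k0. mult_minus m (l+k0)) (\<lambda>k0. T_minus q l T (l+k0))"
  have fin: "finite (?J k)" if "k \<in> {l-1..2*l-2}" for k
    using assms(7) that by (auto simp: mid_multiplicities_def)
  have iso: "iso_over q gens_mid (tensor_power q (T 1) N) (dsum (Z ?X))"
    using assms(7) by (auto simp: mid_multiplicities_def Z_def)
  \<comment> \<open>Both \<open>l-1\<close> and \<open>l+k0\<close> with \<open>k0 < l-1\<close> lie
    in the range \<open>l-1\<close> to \<open>2*l-2\<close> covered by \<open>fin\<close>.\<close>
  have fin': "finite (?J (l-1))" "\<And>k0. k0 < l - 1 \<Longrightarrow> finite (?J (l+k0))"
    using assms(1) by (intro fin; simp; linarith)+
  have wf_T: "well_formed UNIV (T k)" for k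
  proof -
    have "is_module q UNIV (T k)"
      using assms(6)[of k] unfolding is_T_def indecomposable_def gens_big_def by blast
    then show ?thesis by (rule is_module_well_formed)
  qed
  have wf_X: "well_formed UNIV (?X k j)" for k j
    by (intro well_formed_tensor well_formed_weight_module wf_T)
  have wf_Y: "well_formed UNIV (?Y k j)" for k j
    by (simp add: T_plus_def T_minus_def wf_T well_formed_tensor well_formed_weight_module)
  have wf_Z: "well_formed gens_small M" if "\<And>k j. well_formed UNIV (C k j)" "M \<in> set (Z C)" for C M
    using that(2) fin' by (auto simp: Z_def set_copies intro: well_formed_subset[OF that(1)] well_formed_subset[OF wf_T])
  note wf_ZX = wf_Z[of ?X, OF wf_X] and wf_ZY = wf_Z[of ?Y, OF wf_Y]
  \<comment> \<open>For even \<open>j\<close> the scalar is 1 and the factor disappears. For odd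
    \<open>j\<close> it is -1, the value at weight \<open>l\<close> that defines
    \<open>T_minus\<close>.\<close>
  have agree: "agree_on gens_small (?X k j) (?Y k j)" for k j
    using agree_on_tensor_weight[OF wf_T, of q "int l * j" "int l" k]
      agree_on_tensor_weight_trivial[OF wf_T, of q "int l * j" k]
      primitive_root_powi[OF assms(5), of j] primitive_root_half[OF assms(5)]
    by (simp add: T_plus_def T_minus_def)
  have summands: "list_all2 (agree_on gens_small) (concat (map (\<lambda>k0. copies (?J (l+k0)) (m (l+k0)) (?X (l+k0))) ks))
     (concat (map (\<lambda>k0. copies (?J (l+k0)) (m (l+k0)) (?Y (l+k0))) ks))" if "set ks \<subseteq> {..<l-1}" for ks
    using that
  proof (induction ks)
    case (Cons k ks)
    then have "list_all2 (agree_on gens_small) (copies (?J (l+k)) (m (l+k)) (?X (l+k))) (copies (?J (l+k)) (m (l+k)) (?Y (l+k)))"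
      by (intro list_all2_agree_on_copies agree fin') auto
    with Cons show ?case by (auto intro!: list_all2_appendI)
  qed simp
  have "list_all2 (agree_on gens_small) (Z ?X) (Z ?Y)"
    unfolding Z_def
    by (intro list_all2_appendI list_all2_agree_on_refl list_all2_agree_on_copies agree fin'(1) summands) auto
  then have XY: "iso_over q gens_small (dsum (Z ?X)) (dsum (Z ?Y))"
    by (intro iso_over_agree agree_on_dsum well_formed_dsum wf_ZX)
  \<comment> \<open>Truncated subtraction would break this for \<open>l < 2\<close>.\<close>
  have I: "set [0..<l-1] = {0..l-2}" "distinct [0..<l-1]" using assms(1) by auto
  have "mset (concat (map (\<lambda>k0. copies (?J (l+k0)) (m (l+k0)) (?Y (l+k0))) [0..<l-1])) =
     (\<Sum>k0\<leftarrow>[0..<l-1]. mset (copies (?J (l+k0)) (m (l+k0)) (?Y (l+k0))))"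
    by (simp add: mset_concat comp_def)
  also have "\<dots> = (\<Sum>k0\<in>{0..l-2}. mset (copies (?J (l+k0)) (m (l+k0)) (?Y (l+k0))))"
    unfolding sum_list_distinct_conv_sum_set[OF I(2)] I(1) ..
  also have "\<dots> = (\<Sum>k0\<in>{0..l-2}. replicate_mset (mult_plus m (l+k0)) (T_plus T (l+k0))
        + replicate_mset (mult_minus m (l+k0)) (T_minus q l T (l+k0)))"
    using assms(1) by (intro sum.cong refl mset_copies_parity fin') auto
  \<comment> \<open>In \<open>Z ?Y\<close> both signs appear for each \<open>k0\<close> in turn,
    while \<open>R\<close> lists all \<open>T_plus\<close> before all \<open>T_minus\<close>;
    splitting the sum over \<open>k0\<close> identifies the multisets.\<close>
  finally have mset: "mset (Z ?Y) = mset R"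
    unfolding Z_def R_def mset_append mset_copies_parity[where m = m and k = "l-1", OF fin'(1)]
    by (simp add: mset_copies sum.distrib)
  have YR: "iso_over q gens_small (dsum (Z ?Y)) (dsum R)"
    by (rule iso_over_dsum_mset[OF mset wf_ZY])
  \<comment> \<open>Carries well-formedness of the summands over to \<open>R\<close>.\<close>
  have set: "set (Z ?Y) = set R" by (rule mset_eq_setD[OF mset])
  have wf: "well_formed gens_small (dsum (Z ?X))" "well_formed gens_small (dsum (Z ?Y))"
      "well_formed gens_small (dsum R)" "well_formed gens_small (tensor_power q (T 1) N)"
    by (rule well_formed_dsum, erule wf_ZX, rule well_formed_dsum, erule wf_ZY,
        rule well_formed_dsum, rule wf_ZY, simp only: set,
        rule well_formed_subset[OF well_formed_tensor_power[OF wf_T] subset_UNIV])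
  have "gens_small \<subseteq> gens_mid" by (auto simp: gens_small_def gens_mid_def)
  \<comment> \<open>The chain runs from the tensor power through \<open>Z ?X\<close> and
    \<open>Z ?Y\<close> to \<open>R\<close>; only its first link is a restriction from
    \<open>gens_mid\<close>.\<close>
  from iso_over_trans[OF wf(4,1,3) iso_over_mono[OF iso this] iso_over_trans[OF wf(1-3) XY YR]]
  show ?thesis by (simp only: R_def)
qed

end
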